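(* Let $K\in[0,\mu(\Omega)]$ and $\rho>0$. Then each of the following three problems possesses a global minimizer: (1) minimize $f(u)$ over $u\in U$ subject to $\|\nabla u\|_0\le K$; (2) minimize $f(u)$ over $u\in U$ subject to $\|W(u)\|_1-|||W(u)|||_K=0$; (3) minimize $f_\rho(u):=f(u)+\rho\,\phi(u)$ over $u\in U$, where $\phi(u):=\|W(u)\|_1-|||W(u)|||_K$.
   Context: Standing assumptions: $\Omega\subseteq\mathbb{R}^d$ ($d\in\mathbb{N}$) is open and bounded, $\mu$ is the Lebesgue measure. $U$ is a reflexive Banach space that is compactly embedded in $H^1(\Omega)$ and dense in $L^1(\Omega)$. The objective $f\colon U\to\mathbb{R}\cup\{+\infty\}$ is proper, convex, lower semicontinuous, bounded from below and radially unbounded (i.e. $f(u)\to+\infty$ as $\|u\|_U\to\infty$). There exists $u\in U$ with $f(u)<\infty$ and $\|\nabla u\|_0\le K$. Notation: $\nabla u=(\partial u/\partial x_1,\dots,\partial u/\partial x_d)^\top$ is the weak gradient of $u\in U$, and $W(u):=\sum_{i=1}^d(\partial u/\partial x_i)^2\in L^1(\Omega)$. The support of the gradient is $\operatorname{supp}(\nabla u):=\{x\in\Omega: \nabla u(x)\ne 0\}=\operatorname{supp}(W(u))$ (set-theoretic support, up to null sets), and $\|\nabla u\|_0:=\mu(\operatorname{supp}(\nabla u))$. $\|\cdot\|_1$ is the $L^1(\Omega)$-norm. For $v\in L^1(\Omega)$ the largest-$K$-norm is $|||v|||_K:=\sup\{\int_A|v|\,d\mu : A\subseteq\Omega \text{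 measurable},\ \mu(A)\le K\}$. *)

theory Defs
  imports "HOL-Analysis.Analysis"
begin

text \<open>
  Elements of \<open>L\<^sup>1(\<Omega>)\<close>, \<open>L\<^sup>2(\<Omega>)\<close> and \<open>H\<^sup>1(\<Omega>)\<close> are represented by functions on \<open>\<real>\<^sup>d\<close> of which only
  the values on \<open>\<Omega>\<close> matter; equality in these spaces is equality almost everywhere on \<open>\<Omega>\<close>.
\<close>

section \<open>Weak derivatives and \<open>H\<^sup>1\<close>\<close>

definition classical_partial :: "'d::finite \<Rightarrow> (real^'d \<Rightarrow> real) \<Rightarrow> real^'d \<Rightarrow> real" where
  "classical_partial i \<phi> x = frechet_derivative \<phi> (at x) (axis i 1)"

primrec C_k :: "nat \<Rightarrow> (real^'d::finite \<Rightarrow> real) \<Rightarrow> bool" where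
  "C_k 0 \<phi> \<longleftrightarrow> continuous_on UNIV \<phi>"
| "C_k (Suc k) \<phi> \<longleftrightarrow> (\<forall>x. \<phi> differentiable (at x)) \<and> (\<forall>i. C_k k (classical_partial i \<phi>))"

definition test_function :: "(real^'d::finite) set \<Rightarrow> (real^'d \<Rightarrow> real) \<Rightarrow> bool" where
  "test_function \<Omega> \<phi> \<longleftrightarrow> (\<forall>k. C_k k \<phi>) \<and>
     compact (closure {x. \<phi> x \<noteq> 0}) \<and> closure {x. \<phi> x \<noteq> 0} \<subseteq> \<Omega>"

definition locally_integrable :: "(real^'d::finite) set \<Rightarrow> (real^'d \<Rightarrow> real) \<Rightarrow> bool" where
  "locally_integrable \<Omega> u \<longleftrightarrow> u \<in> borel_measurable (lebesgue_on \<Omega>) \<and>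
     (\<forall>C. compact C \<and> C \<subseteq> \<Omega> \<longrightarrow> integrable (lebesgue_on C) u)"

definition has_weak_partial ::
    "(real^'d::finite) set \<Rightarrow> (real^'d \<Rightarrow> real) \<Rightarrow> 'd \<Rightarrow> (real^'d \<Rightarrow> real) \<Rightarrow> bool" where
  "has_weak_partial \<Omega> u i v \<longleftrightarrow> locally_integrable \<Omega> u \<and> locally_integrable \<Omega> v \<and>
     (\<forall>\<phi>. test_function \<Omega> \<phi> \<longrightarrow>
        (LINT x|lebesgue_on \<Omega>. u x * classical_partial i \<phi> x) = - (LINT x|lebesgue_on \<Omega>. v x * \<phi> x))"

definition has_weak_gradient ::
    "(real^'d::finite) set \<Rightarrow> (real^'d \<Rightarrow> real) \<Rightarrow> (real^'d \<Rightarrow> real^'d) \<Rightarrow> bool" where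
  "has_weak_gradient \<Omega> u g \<longleftrightarrow> (\<forall>i. has_weak_partial \<Omega> u i (\<lambda>x. g x $ i))"

text \<open>
  The weak gradient is unique up to null sets of \<open>\<Omega>\<close>, so the choice of a representative is immaterial
  for everything below.
\<close>
definition weak_gradient :: "(real^'d::finite) set \<Rightarrow> (real^'d \<Rightarrow> real) \<Rightarrow> real^'d \<Rightarrow> real^'d" where
  "weak_gradient \<Omega> u = (SOME g. has_weak_gradient \<Omega> u g)"

definition L1 :: "(real^'d::finite) set \<Rightarrow> (real^'d \<Rightarrow> real) set" where
  "L1 \<Omega> = {v. integrable (lebesgue_on \<Omega>) v}"

definition L1_norm :: "(real^'d::finite) set \<Rightarrow> (real^'d \<Rightarrow> real) \<Rightarrow> real" where
  "L1_norm \<Omega> v = (LINT x|lebesgue_on \<Omega>. \<bar>v x\<bar>)"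

definition L2 :: "(real^'d::finite) set \<Rightarrow> (real^'d \<Rightarrow> real) set" where
  "L2 \<Omega> = {v. v \<in> borel_measurable (lebesgue_on \<Omega>) \<and> integrable (lebesgue_on \<Omega>) (\<lambda>x. (v x)\<^sup>2)}"

definition H1 :: "(real^'d::finite) set \<Rightarrow> (real^'d \<Rightarrow> real) set" where
  "H1 \<Omega> = {u. u \<in> L2 \<Omega> \<and>
     (\<exists>g. has_weak_gradient \<Omega> u g \<and> (\<forall>i. (\<lambda>x. g x $ i) \<in> L2 \<Omega>))}"

definition H1_norm :: "(real^'d::finite) set \<Rightarrow> (real^'d \<Rightarrow> real) \<Rightarrow> real" where
  "H1_norm \<Omega> u = sqrt ((LINT x|lebesgue_on \<Omega>. (u x)\<^sup>2) +
     (\<Sum>i\<in>UNIV. LINT x|lebesgue_on \<Omega>. (weak_gradient \<Omega> u x $ i)\<^sup>2))"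

section \<open>The space \<open>U\<close>\<close>

text \<open>Reflexivity: the canonical embedding into the bidual is onto.\<close>
definition reflexive_space :: "'u::real_normed_vector itself \<Rightarrow> bool" where
  "reflexive_space _ \<longleftrightarrow>
     (\<forall>F :: ('u \<Rightarrow>\<^sub>L real) \<Rightarrow>\<^sub>L real. \<exists>u::'u. \<forall>g. blinfun_apply F g = blinfun_apply g u)"

text \<open>
  The Banach space \<open>U\<close> is the type \<open>'u\<close>; the inclusion of \<open>U\<close> into \<open>H\<^sup>1(\<Omega>)\<close> is the map \<open>J\<close>, which picks
  a representative \<open>J u\<close> of each element \<open>u\<close> and so is linear and injective up to null sets only.
\<close>
definition compactly_embedded_H1 ::
    "(real^'d::finite) set \<Rightarrow> ('u::real_normed_vector \<Rightarrow> real^'d \<Rightarrow> real) \<Rightarrow> bool" where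
  "compactly_embedded_H1 \<Omega> J \<longleftrightarrow>
     (\<forall>u. J u \<in> H1 \<Omega>) \<and>
     (\<forall>u v. AE x in lebesgue_on \<Omega>. J (u + v) x = J u x + J v x) \<and>
     (\<forall>c u. AE x in lebesgue_on \<Omega>. J (c *\<^sub>R u) x = c * J u x) \<and>
     (\<forall>u v. (AE x in lebesgue_on \<Omega>. J u x = J v x) \<longrightarrow> u = v) \<and>
     (\<exists>C. \<forall>u. H1_norm \<Omega> (J u) \<le> C * norm u) \<and>
     (\<forall>s :: nat \<Rightarrow> 'u. bounded (range s) \<longrightarrow>
        (\<exists>r. \<exists>w\<in>H1 \<Omega>. strict_mono r \<and>
           (\<lambda>n. H1_norm \<Omega> (\<lambda>x. J (s (r n)) x - w x)) \<longlonglongrightarrow> 0))"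

definition dense_in_L1 ::
    "(real^'d::finite) set \<Rightarrow> ('u \<Rightarrow> real^'d \<Rightarrow> real) \<Rightarrow> bool" where
  "dense_in_L1 \<Omega> J \<longleftrightarrow> (\<forall>u. J u \<in> L1 \<Omega>) \<and>
     (\<forall>v\<in>L1 \<Omega>. \<forall>e>0. \<exists>u. L1_norm \<Omega> (\<lambda>x. J u x - v x) < e)"

section \<open>Extended-real-valued functionals\<close>

definition proper_fun :: "('u \<Rightarrow> ereal) \<Rightarrow> bool" where
  "proper_fun f \<longleftrightarrow> (\<forall>u. f u \<noteq> -\<infinity>) \<and> (\<exists>u. f u \<noteq> \<infinity>)"

definition ereal_convex :: "('u::real_vector \<Rightarrow> ereal) \<Rightarrow> bool" where
  "ereal_convex f \<longleftrightarrow> (\<forall>u v. \<forall>t\<in>{0<..<1::real}.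
     f ((1 - t) *\<^sub>R u + t *\<^sub>R v) \<le> ereal (1 - t) * f u + ereal t * f v)"

definition lower_semicontinuous :: "('u::topological_space \<Rightarrow> ereal) \<Rightarrow> bool" where
  "lower_semicontinuous f \<longleftrightarrow> (\<forall>u. f u \<le> Liminf (at u) f)"

definition bounded_from_below :: "('u \<Rightarrow> ereal) \<Rightarrow> bool" where
  "bounded_from_below f \<longleftrightarrow> (\<exists>m::real. \<forall>u. ereal m \<le> f u)"

definition radially_unbounded :: "('u::real_normed_vector \<Rightarrow> ereal) \<Rightarrow> bool" where
  "radially_unbounded f \<longleftrightarrow> (f \<longlongrightarrow> \<infinity>) at_infinity"

section \<open>Gradient sparsity\<close>

definition W :: "(real^'d::finite) set \<Rightarrow> (real^'d \<Rightarrow> real) \<Rightarrow> real^'d \<Rightarrow> real" where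
  "W \<Omega> u x = (\<Sum>i\<in>UNIV. (weak_gradient \<Omega> u x $ i)\<^sup>2)"

definition grad_supp :: "(real^'d::finite) set \<Rightarrow> (real^'d \<Rightarrow> real) \<Rightarrow> (real^'d) set" where
  "grad_supp \<Omega> u = {x\<in>\<Omega>. weak_gradient \<Omega> u x \<noteq> 0}"

definition grad_L0 :: "(real^'d::finite) set \<Rightarrow> (real^'d \<Rightarrow> real) \<Rightarrow> real" where
  "grad_L0 \<Omega> u = measure lebesgue (grad_supp \<Omega> u)"

definition largest_K_norm :: "(real^'d::finite) set \<Rightarrow> real \<Rightarrow> (real^'d \<Rightarrow> real) \<Rightarrow> real" where
  "largest_K_norm \<Omega> K v =
     (SUP A\<in>{A. A \<in> sets lebesgue \<and> A \<subseteq> \<Omega> \<and> measure lebesgue A \<le> K}. LINT x|lebesgue_on A. \<bar>v x\<bar>)"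

definition penalty :: "(real^'d::finite) set \<Rightarrow> real \<Rightarrow> (real^'d \<Rightarrow> real) \<Rightarrow> real" where
  "penalty \<Omega> K u = L1_norm \<Omega> (W \<Omega> u) - largest_K_norm \<Omega> K (W \<Omega> u)"

end

theory Submission
  imports Defs
begin

text \<open>
  A minimizing sequence is bounded by radial unboundedness. The closed convex hulls of its tails are
  nested bounded closed convex sets, so by reflexivity they have a common point \<open>u\<close> (Smulian). Closed
  convex sublevel sets give \<open>f u \<le> lim f(u\<^sub>n)\<close>. The compact embedding makes \<open>u\<^sub>n\<close> converge in
  \<open>H\<^sup>1(\<Omega>)\<close> along a subsequence, and since balls are convex as well the limit can only be \<open>u\<close>. Hence
  \<open>W(u\<^sub>n) \<longrightarrow> W(u)\<close> in \<open>L\<^sup>1(\<Omega>)\<close>, under which the penalty is continuous and \<open>\<parallel>\<nabla>u\<parallel>\<^sub>0\<close> is lower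
  semicontinuous. Working with weak gradients up to null sets needs their uniqueness, i.e. the fundamental lemma
  of the calculus of variations.
\<close>

section \<open>Hahn--Banach and nested convex sets in reflexive spaces\<close>

text \<open>\<open>J\<close> is linear only almost everywhere and H1 consists of representatives, so
  no norm topology on H1 is set up. The analysis goes through one real functional, the integral of
  \<open>W\<close>, which is convex and obeys a two-term bound for sums. This also determines how
  the limit is identified: for the hull point \<open>u\<close> and the H1-limit \<open>w\<close> it
  is shown that the gradients of \<open>J u\<close> and \<open>w\<close> agree almost everywhere,
  and the gradient is all that the constraints and the penalty see. Neither the measure of the
  support nor the penalty is convex in general, so a common point of the hulls says nothing about
  them; strong convergence of the gradients does. Convexity enters only through \<open>f\<close> and
  through the squared gradient distance to \<open>w\<close>.\<close>

definition sublinear :: "('a::real_vector \<Rightarrow> real) \<Rightarrow> bool" where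
  "sublinear p \<longleftrightarrow> (\<forall>x y. p (x + y) \<le> p x + p y) \<and> (\<forall>t\<ge>0. \<forall>x. p (t *\<^sub>R x) = t * p x)"

text \<open>Applying the inequality with \<open>inverse t\<close> gives the reverse one, so the
  infima built later need homogeneity in one direction only.\<close>

lemma sublinearI:
  assumes "\<And>x y. p (x + y) \<le> p x + p y" and "\<And>t x. t > 0 \<Longrightarrow> p (t *\<^sub>R x) \<le> t * p x" and "p 0 = 0"
  shows "sublinear p"
proof -
  have "p (t *\<^sub>R x) = t * p x" if "t \<ge> 0" for t x
  proof (cases "t = 0")
    case False
    then have t: "t > 0" using that by simp
    have "p x = p (inverse t *\<^sub>R (t *\<^sub>R x))" using t by simp
    also have "\<dots> \<le> inverse t * p (t *\<^sub>R x)" using assms(2)[of "inverse t" "t *\<^sub>R x"] t by simp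
    finally have "t * p x \<le> p (t *\<^sub>R x)" using t by (simp add: field_simps)
    with assms(2)[OF t] show ?thesis by (simp add: antisym)
  qed (simp add: assms)
  then show ?thesis using assms by (simp add: sublinear_def)
qed

lemma sublinear_add: "sublinear p \<Longrightarrow> p (x + y) \<le> p x + p y"
  and sublinear_scaleR: "sublinear p \<Longrightarrow> t \<ge> 0 \<Longrightarrow> p (t *\<^sub>R x) = t * p x"
  by (auto simp: sublinear_def)

lemma sublinear_0: "sublinear p \<Longrightarrow> p 0 = 0"
  using sublinear_scaleR[of p 0 0] by simp

lemma sublinear_minus: "sublinear p \<Longrightarrow> - p (- x) \<le> p x"
  using sublinear_add[of p x "- x"] sublinear_0[of p] by simp

text \<open>Provides the lower bound of a chain for Zorn's lemma. The bound
  \<open>- p (- x) \<le> q x\<close> keeps the infimum finite; for subadditivity two members of the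
  chain are replaced by the smaller one.\<close>

lemma sublinear_INF_chain:
  fixes C :: "('a::real_vector \<Rightarrow> real) set"
  assumes sub: "\<And>q. q \<in> C \<Longrightarrow> sublinear q" and le: "\<And>q x. q \<in> C \<Longrightarrow> q x \<le> p x"
    and ne: "C \<noteq> {}" and chain: "\<And>q r. q \<in> C \<Longrightarrow> r \<in> C \<Longrightarrow> q \<le> r \<or> r \<le> q"
  shows "sublinear (\<lambda>x. INF q\<in>C. q x)" and "\<And>q x. q \<in> C \<Longrightarrow> (INF q\<in>C. q x) \<le> q x"
proof -
  have "- p (- x) \<le> q x" if "q \<in> C" for q x
    using sublinear_minus[OF sub[OF that], of x] le[OF that, of "- x"] by simp
  then have bdd: "bdd_below ((\<lambda>q. q x) ` C)" for x by (auto intro!: bdd_belowI2)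
  show low: "(INF q\<in>C. q x) \<le> q x" if "q \<in> C" for q x using bdd that by (rule cINF_lower)
  show "sublinear (\<lambda>x. INF q\<in>C. q x)"
  proof (rule sublinearI)
    fix x y
    have "(INF q\<in>C. q (x + y)) \<le> q x + r y" if "q \<in> C" "r \<in> C" for q r
    proof -
      obtain s where s: "s \<in> C" "s \<le> q" "s \<le> r" using chain[OF \<open>q \<in> C\<close> \<open>r \<in> C\<close>] \<open>q \<in> C\<close> \<open>r \<in> C\<close> by blast
      have "(INF q\<in>C. q (x + y)) \<le> s (x + y)" using low s by blast
      also have "\<dots> \<le> s x + s y" using sub s sublinear_add by blast
      also have "\<dots> \<le> q x + r y" using s by (simp add: add_mono le_funD)
      finally show ?thesis .
    qed
    then have "(INF q\<in>C. q (x + y)) - r y \<le> (INF q\<in>C. q x)" if "r \<in> C" for r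
      using that ne by (intro cINF_greatest) (auto simp: algebra_simps)
    then have "(INF q\<in>C. q (x + y)) - (INF q\<in>C. q x) \<le> (INF q\<in>C. q y)"
      using ne by (intro cINF_greatest) (auto simp: algebra_simps)
    then show "(INF q\<in>C. q (x + y)) \<le> (INF q\<in>C. q x) + (INF q\<in>C. q y)" by simp
  next
    fix t x assume t: "(t::real) > 0"
    have "(INF q\<in>C. q (t *\<^sub>R x)) / t \<le> q x" if "q \<in> C" for q
      using low[OF that, of "t *\<^sub>R x"] t sub[OF that] by (simp add: sublinear_scaleR field_simps)
    then have "(INF q\<in>C. q (t *\<^sub>R x)) / t \<le> (INF q\<in>C. q x)" using ne by (intro cINF_greatest) auto
    then show "(INF q\<in>C. q (t *\<^sub>R x)) \<le> t * (INF q\<in>C. q x)" using t by (simp add: field_simps)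
  next
    have "(\<lambda>q. q 0) ` C = {0}" using ne sub by (auto simp: sublinear_0)
    then show "(INF q\<in>C. q 0) = 0" by simp
  qed
qed

text \<open>The infimum \<open>r\<close> of \<open>q\<close> along rays in direction
  \<open>y\<close>, corrected by \<open>t * q y\<close>, is again sublinear and below
  \<open>q\<close>, so it equals \<open>q\<close>. Its bound at \<open>- y\<close> with
  \<open>t = 1\<close> reads \<open>q (- y) \<le> - q y\<close>.\<close>

lemma minimal_sublinear_minus:
  fixes q :: "'a::real_vector \<Rightarrow> real"
  assumes q: "sublinear q" and min: "\<And>r. sublinear r \<Longrightarrow> r \<le> q \<Longrightarrow> r = q"
  shows "q (- y) = - q y"
proof -
  define r where "r x = (INF t\<in>{0..}. q (x + t *\<^sub>R y) - t * q y)" for x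
  have "- q (- x) \<le> q (x + t *\<^sub>R y) - t * q y" if "t \<ge> 0" for t x
    using sublinear_add[OF q, of "x + t *\<^sub>R y" "- x"] sublinear_scaleR[OF q that, of y] by simp
  then have bdd: "bdd_below ((\<lambda>t. q (x + t *\<^sub>R y) - t * q y) ` {0..})" for x
    by (auto intro!: bdd_belowI2)
  have low: "r x \<le> q (x + t *\<^sub>R y) - t * q y" if "t \<ge> 0" for t x
    unfolding r_def using bdd that by (intro cINF_lower) auto
  have great: "c \<le> r x" if "\<And>t. t \<ge> 0 \<Longrightarrow> c \<le> q (x + t *\<^sub>R y) - t * q y" for c x
    unfolding r_def using that by (intro cINF_greatest) auto
  have "sublinear r"
  proof (rule sublinearI)
    fix u v
    have key: "r (u + v) \<le> (q (u + s *\<^sub>R y) - s * q y) + (q (v + t *\<^sub>R y) - t * q y)" if "s \<ge> 0" "t \<ge> 0" for s t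
      using low[of "s + t" "u + v"] that sublinear_add[OF q, of "u + s *\<^sub>R y" "v + t *\<^sub>R y"]
      by (simp add: algebra_simps)
    have "r (u + v) - (q (u + s *\<^sub>R y) - s * q y) \<le> r v" if "s \<ge> 0" for s
      by (rule great) (use key[OF that] in \<open>simp add: diff_le_eq add.commute\<close>)
    then have "r (u + v) - r v \<le> r u" by (intro great) (simp add: diff_le_eq add.commute)
    then show "r (u + v) \<le> r u + r v" by simp
  next
    fix t :: real and x assume t: "t > 0"
    have "r (t *\<^sub>R x) / t \<le> r x"
    proof (rule great)
      fix s :: real assume s: "s \<ge> 0"
      have "r (t *\<^sub>R x) \<le> q (t *\<^sub>R (x + s *\<^sub>R y)) - (t * s) * q y"
        using low[of "t * s" "t *\<^sub>R x"] s t by (simp add: scaleR_add_right)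
      also have "\<dots> = t * (q (x + s *\<^sub>R y) - s * q y)"
        using t by (simp only: sublinear_scaleR[OF q less_imp_le]) (simp add: algebra_simps)
      finally show "r (t *\<^sub>R x) / t \<le> q (x + s *\<^sub>R y) - s * q y" using t by (simp add: field_simps)
    qed
    then show "r (t *\<^sub>R x) \<le> t * r x" using t by (simp add: field_simps)
  next
    have "0 \<le> r 0" by (rule great) (simp add: sublinear_scaleR[OF q])
    with low[of 0 0] show "r 0 = 0" by (simp add: sublinear_0[OF q])
  qed
  moreover have "r \<le> q" using low[of 0] by (simp add: le_fun_def)
  ultimately have "r = q" by (rule min)
  with low[of 1 "- y"] have "q (- y) \<le> - q y" by (simp add: sublinear_0[OF q])
  with sublinear_minus[OF q, of y] show ?thesis by simp
qed

text \<open>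
  Zorn's lemma applied to sublinear functionals instead of to partially defined linear ones: a minimal
  sublinear functional is linear.
\<close>
theorem Hahn_Banach_sublinear:
  fixes p :: "'a::real_vector \<Rightarrow> real"
  assumes p: "sublinear p"
  obtains F where "linear F" and "\<And>x. F x \<le> p x"
proof -
  let ?A = "{q. sublinear q \<and> q \<le> p}"
  \<comment> \<open>Zorn's lemma gives a maximal element; for the reversed order this is a minimal
    sublinear functional below \<open>p\<close>.\<close>
  have "\<exists>m\<in>?A. \<forall>a\<in>?A. m \<ge> a \<longrightarrow> a = m"
  proof (rule predicate_Zorn)
    show "partial_order_on ?A (relation_of (\<ge>) ?A)"
      by (rule partial_order_on_relation_ofI) auto
    fix C assume C: "C \<in> Chains (relation_of (\<ge>) ?A)"
    show "\<exists>u\<in>?A. \<forall>a\<in>C. u \<le> a"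
    proof (cases "C = {}")
      case True
      then show ?thesis using p by auto
    next
      case False
      have sub: "sublinear q" "q x \<le> p x" if "q \<in> C" for q x
        using C that by (auto simp: Chains_def relation_of_def le_fun_def)
      have chain: "q \<le> r \<or> r \<le> q" if "q \<in> C" "r \<in> C" for q r
        using C that by (auto simp: Chains_def relation_of_def)
      have I: "sublinear (\<lambda>x. INF q\<in>C. q x)"
        by (rule sublinear_INF_chain(1)[where p = p]) (use sub False chain in auto)
      have le: "(INF q\<in>C. q x) \<le> q x" if "q \<in> C" for q x
        by (rule sublinear_INF_chain(2)[where p = p]) (use sub False chain that in auto)
      obtain q0 where "q0 \<in> C" using False by blast
      then have "(INF q\<in>C. q x) \<le> p x" for x using le sub(2) by (meson order_trans)
      then have "(\<lambda>x. INF q\<in>C. q x) \<in> ?A" using I by (simp add: le_fun_def)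
      then show ?thesis using le by (intro bexI[of _ "\<lambda>x. INF q\<in>C. q x"]) (auto simp: le_fun_def)
    qed
  qed
  then obtain q where q: "sublinear q" "q \<le> p" and min: "\<And>r. sublinear r \<Longrightarrow> r \<le> q \<Longrightarrow> r = q"
    by (auto intro: order_trans[of _ _ p])
  note minus = minimal_sublinear_minus[OF q(1) min]
  have "linear q"
  proof (rule linearI)
    show "q (x + y) = q x + q y" for x y
      using sublinear_add[OF q(1), of x y] sublinear_add[OF q(1), of "x + y" "- y"] minus[of y] by simp
    show "q (c *\<^sub>R x) = c *\<^sub>R q x" for c x
    proof (cases "c \<ge> 0")
      case False
      then show ?thesis using sublinear_scaleR[OF q(1), of "- c" x] minus[of "c *\<^sub>R x"] by simp
    qed (simp add: sublinear_scaleR[OF q(1)])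
  qed
  with q(2) show ?thesis by (intro that) (auto simp: le_fun_def)
qed

text \<open>\<open>p\<close> is the largest sublinear functional that is below the norm and at most
  \<open>- \<delta>\<close> at every \<open>z - c\<close>. A linear functional below it inherits
  both properties: \<open>t = 0\<close> gives boundedness, \<open>t = 1\<close> the gap. The
  distance assumption keeps the infimum finite.\<close>

lemma separating_functional:
  fixes C :: "'a::real_normed_vector set"
  assumes C: "convex C" "C \<noteq> {}" and far: "\<And>c. c \<in> C \<Longrightarrow> \<delta> \<le> norm (c - z)"
  obtains g :: "'a \<Rightarrow>\<^sub>L real" where "\<And>c. c \<in> C \<Longrightarrow> g z + \<delta> \<le> g c"
proof -
  let ?S = "{0..} \<times> C"
  define p where "p x = (INF (t, c)\<in>?S. norm (x + t *\<^sub>R (c - z)) - t * \<delta>)" for x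
  have "- norm x \<le> norm (x + t *\<^sub>R (c - z)) - t * \<delta>" if "t \<ge> 0" "c \<in> C" for t c x
  proof -
    have "t * \<delta> \<le> norm (t *\<^sub>R (c - z))" using far[OF that(2)] that by (simp add: mult_left_mono)
    also have "\<dots> \<le> norm (x + t *\<^sub>R (c - z)) + norm x"
      using norm_triangle_ineq4[of "x + t *\<^sub>R (c - z)" x] by simp
    finally show ?thesis by simp
  qed
  then have bdd: "bdd_below ((\<lambda>(t, c). norm (x + t *\<^sub>R (c - z)) - t * \<delta>) ` ?S)" for x
    by (auto intro!: bdd_belowI2)
  have low: "p x \<le> norm (x + t *\<^sub>R (c - z)) - t * \<delta>" if "t \<ge> 0" "c \<in> C" for t c x
    using cINF_lower[OF bdd[of x], of "(t, c)"] that by (simp add: p_def)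
  have great: "b \<le> p x" if "\<And>t c. t \<ge> 0 \<Longrightarrow> c \<in> C \<Longrightarrow> b \<le> norm (x + t *\<^sub>R (c - z)) - t * \<delta>" for b x
    unfolding p_def using that C(2) by (intro cINF_greatest) auto
  obtain c0 where c0: "c0 \<in> C" using C(2) by blast
  have "sublinear p"
  proof (rule sublinearI)
    fix u v
    have key: "p (u + v) \<le> (norm (u + s *\<^sub>R (c - z)) - s * \<delta>) + (norm (v + t *\<^sub>R (d - z)) - t * \<delta>)"
      if "s \<ge> 0" "t \<ge> 0" "c \<in> C" "d \<in> C" for s t c d
    proof (cases "s + t = 0")
      case True
      then have "s = 0" "t = 0" using that by auto
      then show ?thesis using low[of 0 c "u + v"] that norm_triangle_ineq[of u v] by simp
    next
      case False
      then have st: "s + t > 0" using that by simp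
      \<comment> \<open>Weights proportional to \<open>s\<close> and \<open>t\<close> merge the two
        competitors into one with parameter \<open>s + t\<close>; this is where convexity of
        \<open>C\<close> makes \<open>p\<close> subadditive.\<close>
      define e where "e = (s / (s + t)) *\<^sub>R c + (t / (s + t)) *\<^sub>R d"
      have "e \<in> C" unfolding e_def
        using that st by (intro convexD[OF C(1)]) (auto simp flip: add_divide_distrib)
      moreover have "(s + t) *\<^sub>R e = s *\<^sub>R c + t *\<^sub>R d" using st by (simp add: e_def scaleR_add_right)
      then have "u + v + (s + t) *\<^sub>R (e - z) = (u + s *\<^sub>R (c - z)) + (v + t *\<^sub>R (d - z))"
        by (simp add: scaleR_diff_right scaleR_add_left)
      ultimately show ?thesis
        using low[of "s + t" e "u + v"] that norm_triangle_ineq[of "u + s *\<^sub>R (c - z)" "v + t *\<^sub>R (d - z)"]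
        by (simp add: algebra_simps)
    qed
    have "p (u + v) - (norm (u + s *\<^sub>R (c - z)) - s * \<delta>) \<le> p v" if "s \<ge> 0" "c \<in> C" for s c
      by (rule great) (use key[OF that(1) _ that(2)] in \<open>simp add: diff_le_eq add.commute\<close>)
    then have "p (u + v) - p v \<le> p u" by (intro great) (simp add: diff_le_eq add.commute)
    then show "p (u + v) \<le> p u + p v" by simp
  next
    fix t :: real and x assume t: "t > 0"
    have "p (t *\<^sub>R x) / t \<le> p x"
    proof (rule great)
      fix s :: real and c assume s: "s \<ge> 0" "c \<in> C"
      have "p (t *\<^sub>R x) \<le> norm (t *\<^sub>R (x + s *\<^sub>R (c - z))) - t * s * \<delta>"
        using low[of "t * s" c "t *\<^sub>R x"] s t by (simp only: scaleR_add_right) simp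
      also have "\<dots> = t * (norm (x + s *\<^sub>R (c - z)) - s * \<delta>)"
        using t by (simp only: norm_scaleR abs_of_pos) (simp add: right_diff_distrib)
      finally show "p (t *\<^sub>R x) / t \<le> norm (x + s *\<^sub>R (c - z)) - s * \<delta>" using t by (simp add: field_simps)
    qed
    then show "p (t *\<^sub>R x) \<le> t * p x" using t by (simp add: field_simps)
  next
    have "0 \<le> p 0"
    proof (rule great)
      fix t :: real and c assume "t \<ge> 0" "c \<in> C"
      then show "0 \<le> norm (0 + t *\<^sub>R (c - z)) - t * \<delta>" using far by (simp add: mult_left_mono)
    qed
    with low[of 0 c0 0] c0 show "p 0 = 0" by simp
  qed
  then obtain F where F: "linear F" "\<And>x. F x \<le> p x" using Hahn_Banach_sublinear by blast
  have le: "F x \<le> norm x" for x using F(2)[of x] low[of 0 c0 x] c0 by simp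
  then have "\<bar>F x\<bar> \<le> norm x" for x using le[of "- x"] linear_neg[OF F(1), of x] by (simp add: abs_le_iff)
  then have "bounded_linear F"
    using F(1) by (intro bounded_linear_intro[of F 1]) (auto simp: linear_add linear_scale)
  then have B: "blinfun_apply (Blinfun F) = F" by (rule bounded_linear_Blinfun_apply)
  have "F z + \<delta> \<le> F c" if "c \<in> C" for c
    using F(2)[of "- (c - z)"] low[of 1 c "- (c - z)"] that linear_diff[OF F(1), of z c] by simp
  then show ?thesis using that[of "Blinfun F"] B by simp
qed

text \<open>
  With \<open>x\<^sub>n \<in> C\<^sub>n\<close>, a linear functional dominated by \<open>g \<mapsto> limsup g(x\<^sub>n)\<close> on the dual is, by
  reflexivity, evaluation at a point of every \<open>C\<^sub>n\<close>.
\<close>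
lemma reflexive_decseq_convex_Inter:
  fixes C :: "nat \<Rightarrow> 'a::real_normed_vector set"
  assumes refl: "reflexive_space TYPE('a)"
    and closed: "\<And>n. closed (C n)" and convex: "\<And>n. convex (C n)" and ne: "\<And>n. C n \<noteq> {}"
    and dec: "decseq C" and bdd: "bounded (C 0)"
  shows "(\<Inter>n. C n) \<noteq> {}"
proof -
  obtain x where x: "\<And>n. x n \<in> C n" using ne by (meson ex_in_conv)
  obtain M where M: "\<And>y. y \<in> C 0 \<Longrightarrow> norm y \<le> M" using bdd by (auto simp: bounded_iff)
  have xM: "norm (x n) \<le> M" for n using M x decseqD[OF dec, of 0 n] by blast
  have gM: "\<bar>g (x n)\<bar> \<le> norm g * M" for g :: "'a \<Rightarrow>\<^sub>L real" and n
    using norm_blinfun[of g "x n"] mult_left_mono[OF xM[of n] norm_ge_zero[of g]] by simp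
  define T where "T g n = (SUP k\<in>{n..}. g (x k))" for g :: "'a \<Rightarrow>\<^sub>L real" and n :: nat
  define p where "p g = (INF n. T g n)" for g :: "'a \<Rightarrow>\<^sub>L real"
  have gbdd: "bdd_above ((\<lambda>k. g (x k)) ` {n..})" for g :: "'a \<Rightarrow>\<^sub>L real" and n
    using gM[of g] by (intro bdd_aboveI2[of _ _ "norm g * M"]) (auto simp: abs_le_iff)
  have Tup: "g (x k) \<le> T g n" if "k \<ge> n" for g :: "'a \<Rightarrow>\<^sub>L real" and k n
    unfolding T_def using that by (intro cSUP_upper gbdd) auto
  have Tlow: "T g n \<le> b" if "\<And>k. k \<ge> n \<Longrightarrow> g (x k) \<le> b" for g :: "'a \<Rightarrow>\<^sub>L real" and n b
    unfolding T_def using that by (intro cSUP_least) auto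
  have "- (norm g * M) \<le> T g n" for g n
    using Tup[of n n g] gM[of g n] by (simp add: abs_le_iff)
  then have Tbdd: "bdd_below (range (T g))" for g by (auto intro!: bdd_belowI2)
  have plow: "p g \<le> T g n" for g n unfolding p_def by (intro cINF_lower Tbdd) auto
  have pgreat: "b \<le> p g" if "\<And>n. b \<le> T g n" for b g unfolding p_def using that by (intro cINF_greatest) auto
  have "sublinear p"
  proof (rule sublinearI)
    fix g h
    have "p (g + h) \<le> T g m + T h n" for m n
    proof -
      have "p (g + h) \<le> T (g + h) (max m n)" by (rule plow)
      also have "\<dots> \<le> T g m + T h n" by (rule Tlow) (auto simp: blinfun.add_left intro!: add_mono Tup)
      finally show ?thesis .
    qed
    then have "p (g + h) - T g m \<le> p h" for m by (intro pgreat) (simp add: algebra_simps)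
    then have "p (g + h) - p h \<le> p g" by (intro pgreat) (simp add: algebra_simps)
    then show "p (g + h) \<le> p g + p h" by simp
  next
    fix t :: real and g assume t: "t > 0"
    have "p (t *\<^sub>R g) / t \<le> T g n" for n
    proof -
      have "p (t *\<^sub>R g) \<le> T (t *\<^sub>R g) n" by (rule plow)
      also have "\<dots> \<le> t * T g n" using t by (intro Tlow) (auto simp: blinfun.scaleR_left intro!: Tup)
      finally show ?thesis using t by (simp add: field_simps)
    qed
    then have "p (t *\<^sub>R g) / t \<le> p g" by (rule pgreat)
    then show "p (t *\<^sub>R g) \<le> t * p g" using t by (simp add: field_simps)
  next
    show "p 0 = 0" by (simp add: p_def T_def)
  qed
  then obtain F where F: "linear F" "\<And>g. F g \<le> p g" using Hahn_Banach_sublinear by blast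
  have le: "F g \<le> norm g * M" for g
  proof -
    have "T g 0 \<le> norm g * M" by (rule Tlow) (use gM[of g] in \<open>auto simp: abs_le_iff\<close>)
    then show ?thesis using F(2)[of g] plow[of g 0] by simp
  qed
  then have "\<bar>F g\<bar> \<le> norm g * M" for g
    using le[of "- g"] linear_neg[OF F(1), of g] by (simp add: abs_le_iff)
  then have "bounded_linear F"
    using F(1) by (intro bounded_linear_intro[of F M]) (auto simp: linear_add linear_scale)
  then have B: "blinfun_apply (Blinfun F) = F" by (rule bounded_linear_Blinfun_apply)
  obtain u where u: "\<And>g. F g = blinfun_apply g u" using refl B unfolding reflexive_space_def by metis
  have "u \<in> C n" for n
  proof (rule ccontr)
    assume "u \<notin> C n"
    then obtain \<delta> where "\<delta> > 0" "ball u \<delta> \<subseteq> - C n"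
      using closed[of n] by (metis ComplI open_Compl open_contains_ball)
    then have \<delta>: "\<delta> > 0" "\<And>c. c \<in> C n \<Longrightarrow> \<delta> \<le> dist u c" by (force simp: not_less[symmetric])+
    then obtain g :: "'a \<Rightarrow>\<^sub>L real" where g: "\<And>c. c \<in> C n \<Longrightarrow> g u + \<delta> \<le> g c"
      using separating_functional[OF convex ne, of n \<delta> u] by (metis dist_commute dist_norm)
    \<comment> \<open>\<open>p\<close> bounds \<open>F\<close> by tail suprema, whereas
      \<open>g\<close> is bounded from below on \<open>C n\<close>; hence the test at
      \<open>- g\<close>, whose values on the tail stay \<open>\<delta>\<close> below its value at
      \<open>u\<close>.\<close>
    have "(- g) u \<le> T (- g) n" using F(2)[of "- g"] plow[of "- g" n] u[of "- g"] by simp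
    also have "\<dots> \<le> - g u - \<delta>"
    proof (rule Tlow)
      fix k assume "n \<le> k"
      then have "x k \<in> C n" using x decseqD[OF dec] by blast
      then show "(- g) (x k) \<le> - g u - \<delta>" using g by (force simp: blinfun.minus_left)
    qed
    finally show False using \<delta>(1) by (simp add: blinfun.minus_left)
  qed
  then show ?thesis by auto
qed

section \<open>The direct method\<close>

text \<open>\<open>Liminf\<close> at \<open>u\<close> ignores the point \<open>u\<close> itself, so
  closedness is tested at limit points, where the bound \<open>c\<close> is met frequently in
  punctured neighbourhoods.\<close>

lemma closed_sublevel:
  assumes "lower_semicontinuous f"
  shows "closed {u. f u \<le> c}"
  unfolding closed_limpt
proof (intro allI impI)
  fix u assume "u islimpt {u. f u \<le> c}"
  then have "frequently (\<lambda>x. f x \<le> c) (at u)"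
    by (simp add: islimpt_iff_eventually frequently_def)
  then have "Liminf (at u) f \<le> c"
    using less_LiminfD[of c "at u" f] by (auto simp: frequently_def not_less[symmetric])
  then show "u \<in> {u. f u \<le> c}"
    using assms by (auto simp: lower_semicontinuous_def intro: order_trans)
qed

lemma convex_sublevel:
  assumes "ereal_convex f" and "\<And>u. f u \<noteq> -\<infinity>"
  shows "convex {u. f u \<le> ereal c}"
  unfolding convex_alt
proof (intro ballI allI impI)
  fix u v and t :: real
  assume u: "u \<in> {u. f u \<le> ereal c}" and v: "v \<in> {u. f u \<le> ereal c}" and t: "0 \<le> t \<and> t \<le> 1"
  obtain a b where ab: "f u = ereal a" "f v = ereal b" "a \<le> c" "b \<le> c"
    using u v assms(2)[of u] assms(2)[of v] by (cases "f u"; cases "f v") auto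
  consider "t = 0" | "t = 1" | "t \<in> {0<..<1}" using t by fastforce
  then show "(1 - t) *\<^sub>R u + t *\<^sub>R v \<in> {u. f u \<le> ereal c}"
  proof cases
    case 3
    then have "f ((1 - t) *\<^sub>R u + t *\<^sub>R v) \<le> ereal (1 - t) * f u + ereal t * f v"
      using assms(1) unfolding ereal_convex_def by blast
    also have "\<dots> = ereal ((1 - t) * a + t * b)" by (simp add: ab)
    also have "(1 - t) * a + t * b \<le> (1 - t) * c + t * c"
      using t ab by (intro add_mono mult_left_mono) auto
    finally show ?thesis by (simp add: algebra_simps)
  qed (use u v in auto)
qed

lemma radially_unbounded_bounded_sublevel:
  assumes "radially_unbounded f"
  shows "bounded {u. f u \<le> ereal c}"
proof -
  have "eventually (\<lambda>u. f u > ereal c) at_infinity"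
    using assms unfolding radially_unbounded_def by (rule order_tendstoD) simp
  then obtain b where b: "\<And>u. b \<le> norm u \<Longrightarrow> ereal c < f u"
    by (auto simp: eventually_at_infinity)
  show ?thesis
    unfolding bounded_iff using b by (intro exI[of _ b]) (force simp: not_le[symmetric])
qed

text \<open>
  Instead of extracting a weakly convergent subsequence, the limit \<open>u\<close> only has to lie in the closed
  convex hull of every tail.
\<close>
lemma direct_method:
  fixes f :: "'u::real_normed_vector \<Rightarrow> ereal" and \<phi> :: "'u \<Rightarrow> real"
  assumes proper: "proper_fun f" and conv: "ereal_convex f" and lsc: "lower_semicontinuous f"
    and below: "bounded_from_below f" and radial: "radially_unbounded f"
    and feasible: "\<exists>u. P u \<and> f u < \<infinity>" and nonneg: "\<And>u. 0 \<le> \<phi> u"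
    and compact: "\<And>s :: nat \<Rightarrow> 'u. bounded (range s) \<Longrightarrow> (\<And>n. P (s n)) \<Longrightarrow>
      \<exists>r u. strict_mono r \<and> P u \<and> (\<lambda>n. \<phi> (s (r n))) \<longlonglongrightarrow> \<phi> u \<and>
        (\<forall>n. u \<in> closure (convex hull ((s \<circ> r) ` {n..})))"
  shows "\<exists>u. is_arg_min (\<lambda>u. f u + ereal (\<phi> u)) P u"
proof -
  let ?F = "\<lambda>u. f u + ereal (\<phi> u)"
  obtain b where b: "\<And>u. ereal b \<le> f u" using below by (auto simp: bounded_from_below_def)
  \<comment> \<open>Since the added term is nonnegative, \<open>?F\<close> controls
    \<open>f\<close>: this bounds \<open>m\<close> from below and keeps the minimizing sequence in a
    bounded sublevel set of \<open>f\<close>.\<close>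
  have fF: "f u \<le> ?F u" for u using nonneg[of u] by (cases "f u") auto
  define m where "m = (INF u\<in>Collect P. ?F u)"
  have low: "m \<le> ?F u" if "P u" for u unfolding m_def using that by (auto intro: INF_lower)
  have "ereal b \<le> m" unfolding m_def using b fF by (auto intro!: INF_greatest intro: order_trans)
  moreover obtain u0 where "P u0" "f u0 < \<infinity>" using feasible by blast
  then have "m < \<infinity>" using low[of u0] by (cases "f u0") auto
  ultimately obtain c where c: "m = ereal c" by (cases m) auto
  have "\<exists>u. P u \<and> ?F u < ereal (c + 1 / Suc n)" for n
  proof -
    have "m < ereal (c + 1 / Suc n)" using c by simp
    then show ?thesis unfolding m_def by (auto simp: INF_less_iff)
  qed
  then obtain s where s: "\<And>n. P (s n)" "\<And>n. ?F (s n) < ereal (c + 1 / Suc n)" by metis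
  have "f (s n) \<le> ereal (c + 1)" for n
  proof -
    have "f (s n) \<le> ereal (c + 1 / Suc n)" using fF s(2) by (meson less_imp_le order_trans)
    also have "\<dots> \<le> ereal (c + 1)" by simp
    finally show ?thesis .
  qed
  then have "bounded (range s)"
    using bounded_subset[OF radially_unbounded_bounded_sublevel[OF radial]] by blast
  from compact[OF this s(1)] obtain r u where r: "strict_mono r" and u: "P u"
    and lim: "(\<lambda>n. \<phi> (s (r n))) \<longlonglongrightarrow> \<phi> u"
    and hull: "\<And>n. u \<in> closure (convex hull ((s \<circ> r) ` {n..}))" by blast
  \<comment> \<open>Convexity is available for \<open>f\<close> but not for \<open>\<phi>\<close>,
    so \<open>\<phi>\<close> is moved to the other side: along the subsequence \<open>f\<close> is
    at most \<open>c + 1 / Suc n - \<phi> (s (r n))\<close>, which tends to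
    \<open>c - \<phi> u\<close>.\<close>
  have *: "f u \<le> ereal (c - \<phi> u + e)" if "e > 0" for e
  proof -
    have "(\<lambda>n. 1 / Suc n - \<phi> (s (r n))) \<longlonglongrightarrow> 0 - \<phi> u"
      by (intro tendsto_intros lim LIMSEQ_Suc lim_1_over_n)
    then have "eventually (\<lambda>n. 1 / Suc n - \<phi> (s (r n)) < e - \<phi> u) sequentially"
      using that by (intro order_tendstoD) auto
    then obtain N where N: "\<And>n. n \<ge> N \<Longrightarrow> 1 / Suc n - \<phi> (s (r n)) < e - \<phi> u"
      by (auto simp: eventually_sequentially)
    have S: "closed {v. f v \<le> ereal (c - \<phi> u + e)}" "convex {v. f v \<le> ereal (c - \<phi> u + e)}"
      using closed_sublevel[OF lsc] convex_sublevel[OF conv] proper by (auto simp: proper_fun_def)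
    have "(s \<circ> r) ` {N..} \<subseteq> {v. f v \<le> ereal (c - \<phi> u + e)}"
    proof clarsimp
      fix n assume "N \<le> n"
      obtain a where a: "f (s (r n)) = ereal a" using s(2)[of "r n"] b[of "s (r n)"]
        by (cases "f (s (r n))") auto
      have "1 / Suc (r n) \<le> (1 / Suc n :: real)"
        using seq_suble[OF r, of n] by (intro divide_left_mono) auto
      then show "f (s (r n)) \<le> ereal (c - \<phi> u + e)"
        using N[OF \<open>N \<le> n\<close>] s(2)[of "r n"] a by simp
    qed
    then have "closure (convex hull ((s \<circ> r) ` {N..})) \<subseteq> {v. f v \<le> ereal (c - \<phi> u + e)}"
      by (intro closure_minimal hull_minimal S)
    then show ?thesis using hull by blast
  qed
  have "f u \<le> ereal (c - \<phi> u)"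
    by (rule ereal_le_epsilon2) (use * in simp)
  then have "?F u \<le> m" using c by (cases "f u") auto
  then have "?F u \<le> ?F v" if "P v" for v using low[OF that] by (rule order_trans)
  then show ?thesis using u unfolding is_arg_min_def by (meson not_less)
qed

section \<open>Smooth bump functions\<close>

lemma classical_partial_eq:
  "(\<phi> has_derivative \<phi>') (at x) \<Longrightarrow> classical_partial i \<phi> x = \<phi>' (axis i 1)"
  unfolding classical_partial_def by (metis frechet_derivative_at)

lemma C_k_SucI:
  assumes "\<And>x. (\<phi> has_derivative \<phi>' x) (at x)" and "\<And>i. C_k k (\<lambda>x. \<phi>' x (axis i 1))"
  shows "C_k (Suc k) \<phi>"
proof -
  have "classical_partial i \<phi> = (\<lambda>x. \<phi>' x (axis i 1))" for i
    using classical_partial_eq[OF assms(1)] by auto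
  then show ?thesis using assms by (auto simp: differentiable_def)
qed

lemma C_k_SucD:
  assumes "C_k (Suc k) \<phi>"
  obtains \<phi>' where "\<And>x. (\<phi> has_derivative \<phi>' x) (at x)" "\<And>i. C_k k (\<lambda>x. \<phi>' x (axis i 1))"
proof -
  have "(\<phi> has_derivative frechet_derivative \<phi> (at x)) (at x)" for x
    using assms frechet_derivative_works by auto
  moreover have "C_k k (\<lambda>x. frechet_derivative \<phi> (at x) (axis i 1))" for i
    using assms by (simp add: classical_partial_def[abs_def])
  ultimately show ?thesis by (rule that)
qed

text \<open>In the product rule one factor stays undifferentiated, so the induction there has to
  lower its class by one.\<close>

lemma C_k_Suc_imp: "C_k (Suc k) \<phi> \<Longrightarrow> C_k k \<phi>"
proof (induction k arbitrary: \<phi>)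
  case 0
  then show ?case
    by (auto intro!: continuous_at_imp_continuous_on differentiable_imp_continuous_within)
next
  case (Suc k)
  have "\<forall>x. \<phi> differentiable (at x)" "\<forall>i. C_k (Suc k) (classical_partial i \<phi>)"
    using iffD1[OF C_k.simps(2) Suc.prems] by blast+
  with Suc.IH show ?case unfolding C_k.simps(2)[of k] by blast
qed

lemma C_k_const: "C_k k (\<lambda>x. c)"
proof (induction k arbitrary: c)
  case (Suc k)
  show ?case by (rule C_k_SucI[where \<phi>' = "\<lambda>_ _. 0"]) (use Suc in auto)
qed simp

lemma C_k_add: "C_k k \<phi> \<Longrightarrow> C_k k \<psi> \<Longrightarrow> C_k k (\<lambda>x. \<phi> x + \<psi> x)"
proof (induction k arbitrary: \<phi> \<psi>)
  case 0
  then show ?case by (auto intro: continuous_intros)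
next
  case (Suc k)
  obtain \<phi>' \<psi>' where d: "\<And>x. (\<phi> has_derivative \<phi>' x) (at x)" "\<And>i. C_k k (\<lambda>x. \<phi>' x (axis i 1))"
    "\<And>x. (\<psi> has_derivative \<psi>' x) (at x)" "\<And>i. C_k k (\<lambda>x. \<psi>' x (axis i 1))"
    using Suc.prems by (elim C_k_SucD) blast
  show ?case
    by (rule C_k_SucI[where \<phi>' = "\<lambda>x h. \<phi>' x h + \<psi>' x h"]) (auto intro!: derivative_intros d Suc.IH)
qed

lemma C_k_mult: "C_k k \<phi> \<Longrightarrow> C_k k \<psi> \<Longrightarrow> C_k k (\<lambda>x. \<phi> x * \<psi> x)"
proof (induction k arbitrary: \<phi> \<psi>)
  case 0
  then show ?case by (auto intro: continuous_intros)
next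
  case (Suc k)
  obtain \<phi>' \<psi>' where d: "\<And>x. (\<phi> has_derivative \<phi>' x) (at x)" "\<And>i. C_k k (\<lambda>x. \<phi>' x (axis i 1))"
    "\<And>x. (\<psi> has_derivative \<psi>' x) (at x)" "\<And>i. C_k k (\<lambda>x. \<psi>' x (axis i 1))"
    using Suc.prems by (elim C_k_SucD) blast
  show ?case
    by (rule C_k_SucI[where \<phi>' = "\<lambda>x h. \<phi> x * \<psi>' x h + \<phi>' x h * \<psi> x"])
      (auto intro!: has_derivative_mult C_k_add d Suc.IH C_k_Suc_imp[OF Suc.prems(1)] C_k_Suc_imp[OF Suc.prems(2)])
qed

lemma C_k_prod: "(\<And>i. i \<in> I \<Longrightarrow> C_k k (\<phi> i)) \<Longrightarrow> C_k k (\<lambda>x. \<Prod>i\<in>I. \<phi> i x)"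
  by (induction I rule: infinite_finite_induct) (auto intro: C_k_const C_k_mult)

text \<open>
  The functions \<open>P(1/t) exp(-1/t)\<close>, extended by \<open>0\<close> to \<open>t \<le> 0\<close>, are closed under differentiation.
\<close>
definition flat :: "real poly \<Rightarrow> real \<Rightarrow> real" where
  "flat P t = (if t > 0 then poly P (1 / t) * exp (- (1 / t)) else 0)"

lemma poly_times_exp_minus_at_top: "((\<lambda>y::real. poly P y * exp (- y)) \<longlongrightarrow> 0) at_top"
proof -
  have "((\<lambda>y. \<Sum>i\<le>degree P. coeff P i * (y ^ i / exp y)) \<longlongrightarrow> (\<Sum>i\<le>degree P. coeff P i * 0)) at_top"
    by (intro tendsto_sum tendsto_mult tendsto_const tendsto_power_div_exp_0)
  then show ?thesis
    by (simp add: poly_altdef sum_distrib_right exp_minus divide_inverse mult.assoc)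
qed

lemma flat_tendsto_0: "(flat P \<longlongrightarrow> 0) (at 0)"
proof (rule filterlim_split_at)
  have "eventually (\<lambda>t. 0 = flat P t) (at_left (0::real))"
    by (simp add: eventually_at_filter flat_def)
  then show "(flat P \<longlongrightarrow> 0) (at_left 0)" by (rule Lim_transform_eventually[OF tendsto_const])
  have "((\<lambda>t. poly P (inverse t) * exp (- inverse t)) \<longlongrightarrow> 0) (at_right 0)"
    by (rule filterlim_compose[OF poly_times_exp_minus_at_top filterlim_inverse_at_top_right])
  moreover have "eventually (\<lambda>t. poly P (inverse t) * exp (- inverse t) = flat P t) (at_right (0::real))"
    by (simp add: eventually_at_filter flat_def inverse_eq_divide)
  ultimately show "(flat P \<longlongrightarrow> 0) (at_right 0)" by (rule Lim_transform_eventually)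
qed

text \<open>For \<open>t > 0\<close> the chain rule produces the factor \<open>1 / t\<^sup>2\<close>
  and the difference of \<open>P\<close> and its derivative at \<open>1 / t\<close>;
  \<open>[:0, 0, 1:]\<close> is the square of the variable.\<close>

lemma flat_has_derivative:
  "(flat P has_field_derivative flat ([:0, 0, 1:] * (P - pderiv P)) t) (at t)"
proof (cases "t = 0")
  case True
  \<comment> \<open>Dividing by \<open>t\<close> multiplies the polynomial by its variable, so the
    difference quotient at 0 is again a \<open>flat\<close> function, whose limit is known.\<close>
  have "flat (pCons 0 P) = (\<lambda>y. (flat P y - flat P 0) / (y - 0))"
    by (auto simp: flat_def fun_eq_iff)
  with flat_tendsto_0[of "pCons 0 P"] show ?thesis
    unfolding has_field_derivative_iff True by (simp add: flat_def)
next
  case False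
  show ?thesis
  proof (cases "t > 0")
    case True
    have "((\<lambda>t. poly P (1 / t) * exp (- (1 / t))) has_field_derivative
        flat ([:0, 0, 1:] * (P - pderiv P)) t) (at t)"
      using True unfolding flat_def
      by (auto intro!: derivative_eq_intros DERIV_chain2[OF poly_DERIV]
          simp: field_simps power2_eq_square)
    then show ?thesis
      by (rule has_field_derivative_transform_within_open[where S = "{0<..}"])
        (use True in \<open>auto simp: flat_def\<close>)
  next
    case neg: False
    have "((\<lambda>t. 0) has_field_derivative flat ([:0, 0, 1:] * (P - pderiv P)) t) (at t)"
      using neg by (simp add: flat_def)
    then show ?thesis
      by (rule has_field_derivative_transform_within_open[where S = "{..<0}"])
        (use neg False in \<open>auto simp: flat_def\<close>)
  qed
qed

text \<open>The polynomial is arbitrary in the induction because each derivative replaces it by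
  another one.\<close>

lemma C_k_flat_affine: "C_k k (\<lambda>x::real^'d::finite. flat P (c * x $ i + e))"
proof (induction k arbitrary: P)
  case 0
  have "continuous_on UNIV (flat P)"
    using DERIV_continuous_on[of UNIV "flat P", OF has_field_derivative_at_within[OF flat_has_derivative]] .
  then have "continuous_on UNIV (\<lambda>x::real^'d. flat P (c * x $ i + e))"
    by (rule continuous_on_compose2) (auto intro!: continuous_intros)
  then show ?case by simp
next
  case (Suc k)
  let ?Q = "[:0, 0, 1:] * (P - pderiv P)"
  show ?case
  proof (rule C_k_SucI[where \<phi>' = "\<lambda>x h. flat ?Q (c * x $ i + e) * (c * h $ i)"])
    fix x :: "real^'d"
    have "((\<lambda>x::real^'d. c * x $ i + e) has_derivative (\<lambda>h. c * h $ i)) (at x)"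
      by (intro has_derivative_add_const has_derivative_mult_right
          bounded_linear_imp_has_derivative bounded_linear_vec_nth)
    moreover have "(flat P has_derivative (\<lambda>h. flat ?Q (c * x $ i + e) * h)) (at (c * x $ i + e))"
      using flat_has_derivative unfolding has_field_derivative_def by blast
    ultimately show "((\<lambda>x. flat P (c * x $ i + e)) has_derivative
        (\<lambda>h. flat ?Q (c * x $ i + e) * (c * h $ i))) (at x)"
      by (rule has_derivative_compose)
  next
    show "C_k k (\<lambda>x::real^'d. flat ?Q (c * x $ i + e) * (c * axis j 1 $ i))" for j
      by (intro C_k_mult C_k_const Suc)
  qed
qed

text \<open>For \<open>n > 0\<close> this is positive exactly on the open box, and \<open>n\<close>
  steepens it towards the indicator. The arguments have the shape \<open>c * x $ i + e\<close> in
  order to match \<open>C_k_flat_affine\<close>.\<close>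

definition box_bump :: "real^'d::finite \<Rightarrow> real^'d \<Rightarrow> nat \<Rightarrow> real^'d \<Rightarrow> real" where
  "box_bump a b n x =
    (\<Prod>i\<in>UNIV. flat 1 (real n * x $ i + - (real n * a $ i)) * flat 1 (- real n * x $ i + real n * b $ i))"

lemma flat_1_tendsto: "(\<lambda>n. flat 1 (real n * t)) \<longlonglongrightarrow> (if t > 0 then 1 else 0)"
proof (cases "t > 0")
  case True
  have "(\<lambda>n. exp (- (1 / real n * (1 / t)))) \<longlonglongrightarrow> exp (- (0 * (1 / t)))"
    by (intro tendsto_intros lim_1_over_n)
  \<comment> \<open>At \<open>n = 0\<close> the convention \<open>1 / 0 = 0\<close> makes the left
    side 1 while \<open>flat 1 0\<close> is 0, so the two agree only for positive
    \<open>n\<close>.\<close>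
  moreover have "eventually (\<lambda>n. exp (- (1 / real n * (1 / t))) = flat 1 (real n * t)) sequentially"
    using eventually_gt_at_top[of 0] by eventually_elim (use True in \<open>auto simp: flat_def\<close>)
  ultimately show ?thesis using True by (auto intro: Lim_transform_eventually)
next
  case False
  then have "flat 1 (real n * t) = 0" for n by (auto simp: flat_def zero_less_mult_iff)
  then show ?thesis using False by simp
qed

lemma box_bump_tendsto:
  fixes a b x :: "real^'d::finite"
  shows "(\<lambda>n. box_bump a b n x) \<longlonglongrightarrow> indicator (box a b) x"
proof -
  have "(\<lambda>n. \<Prod>i\<in>UNIV. flat 1 (real n * (x $ i - a $ i)) * flat 1 (real n * (b $ i - x $ i)))
    \<longlonglongrightarrow> (\<Prod>i\<in>UNIV. (if x $ i - a $ i > 0 then 1 else 0) * (if b $ i - x $ i > 0 then 1 else 0))"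
    by (intro tendsto_prod tendsto_mult flat_1_tendsto)
  also have "(\<Prod>i\<in>UNIV. (if x $ i - a $ i > 0 then 1 else 0) * (if b $ i - x $ i > 0 then 1 else 0)) =
      (indicator (box a b) x :: real)"
    by (auto simp: indicator_def mem_box_cart intro!: prod.neutral)
  finally show ?thesis by (simp add: box_bump_def algebra_simps)
qed

lemma box_bump_bounds: "0 \<le> box_bump a b n x" "box_bump a b n x \<le> 1"
proof -
  have "0 \<le> flat 1 t" "flat 1 t \<le> 1" for t by (auto simp: flat_def)
  then show "0 \<le> box_bump a b n x" "box_bump a b n x \<le> 1"
    unfolding box_bump_def by (auto intro!: prod_nonneg prod_le_1 mult_le_one)
qed

lemma box_bump_eq_0:
  assumes "x \<notin> box a b"
  shows "box_bump a b n x = 0"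
proof -
  obtain i where "x $ i \<le> a $ i \<or> b $ i \<le> x $ i" using assms by (auto simp: mem_box_cart not_less)
  then have "real n * x $ i \<le> real n * a $ i \<or> real n * b $ i \<le> real n * x $ i"
    by (auto intro: mult_left_mono)
  then have "flat 1 (real n * x $ i + - (real n * a $ i)) * flat 1 (- real n * x $ i + real n * b $ i) = 0"
    by (auto simp: flat_def)
  then show ?thesis unfolding box_bump_def by (intro prod_zero) auto
qed

lemma test_function_box_bump:
  assumes "cbox a b \<subseteq> \<Omega>"
  shows "test_function \<Omega> (box_bump a b n)"
proof -
  have "C_k k (box_bump a b n)" for k
    unfolding box_bump_def[abs_def] by (intro C_k_prod C_k_mult C_k_flat_affine)
  moreover have "{x. box_bump a b n x \<noteq> 0} \<subseteq> cbox a b"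
    using box_bump_eq_0 box_subset_cbox by blast
  then have "closure {x. box_bump a b n x \<noteq> 0} \<subseteq> cbox a b" by (simp add: closure_minimal closed_cbox)
  moreover from this have "compact (closure {x. box_bump a b n x \<noteq> 0})"
    using bounded_subset[OF bounded_cbox] by (simp add: compact_eq_bounded_closed)
  ultimately show ?thesis
    using assms unfolding test_function_def by blast
qed

lemma test_function_measurable: "test_function \<Omega> \<phi> \<Longrightarrow> \<phi> \<in> borel_measurable (lebesgue_on S)"
proof -
  assume "test_function \<Omega> \<phi>"
  then have "C_k 0 \<phi>" unfolding test_function_def by blast
  then have "continuous_on UNIV \<phi>" by simp
  then have "\<phi> \<in> borel_measurable lborel" by (simp add: borel_measurable_continuous_onI)
  then show ?thesis by (intro measurable_restrict_space1 measurable_completion)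
qed

section \<open>The fundamental lemma of the calculus of variations\<close>

text \<open>Boxes are stable under intersection and generate the Borel sets, so the integral
  vanishes on every Borel set. A Lebesgue set differs from a Borel one by a null set, and a function
  with vanishing integral over every Lebesgue set is 0 almost everywhere.\<close>

lemma integral_boxes_0_imp_AE_0:
  fixes f :: "'a::euclidean_space \<Rightarrow> real"
  assumes f: "integrable lebesgue f" and boxes: "\<And>a b. (LINT x:box a b|lebesgue. f x) = 0"
  shows "AE x in lebesgue. f x = 0"
proof -
  have si: "set_integrable lebesgue A f" if "A \<in> sets lebesgue" for A
    using that f unfolding set_integrable_def by (rule integrable_mult_indicator)
  \<comment> \<open>The complement step of the induction needs the integral over the whole space; it
    is the limit along an exhausting sequence of boxes.\<close>
  have "(\<lambda>n. LINT x:box (- (real n *\<^sub>R One)) (real n *\<^sub>R One)|lebesgue. f x)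
      \<longlonglongrightarrow> (LINT x:(\<Union>n. box (- (real n *\<^sub>R One)) (real n *\<^sub>R One))|lebesgue. f x)"
    by (intro set_integral_cont_up si)
      (fastforce simp: incseq_def mem_box)+
  then have total: "(LINT x:UNIV|lebesgue. f x) = 0"
    by (simp add: boxes UN_box_eq_UNIV LIMSEQ_const_iff)
  have borel: "(LINT x:A|lebesgue. f x) = 0" if A: "A \<in> sets borel" for A
  proof -
    have "Int_stable (range (\<lambda>(a, b). box a b :: 'a set))"
      by (auto simp: Int_stable_def box_Int_box)
    moreover have "(range (\<lambda>(a, b). box a b :: 'a set)) \<subseteq> Pow UNIV" by auto
    moreover have "A \<in> sigma_sets UNIV (range (\<lambda>(a, b). box a b))" using A unfolding borel_eq_box by simp
    ultimately show ?thesis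
    proof (induction rule: sigma_sets_induct_disjoint)
      case (basic A)
      then show ?case by (auto simp: boxes)
    next
      case empty
      then show ?case by (simp add: set_lebesgue_integral_def)
    next
      case (compl A)
      then have A: "A \<in> sets lebesgue" by (auto simp: borel_eq_box intro!: sets_completionI_sets)
      have "(LINT x:A \<union> (UNIV - A)|lebesgue. f x) = (LINT x:A|lebesgue. f x) + (LINT x:UNIV - A|lebesgue. f x)"
        using A by (intro set_integral_Un si) auto
      then show ?case using compl total by simp
    next
      case (union F)
      have F: "F i \<in> sets lebesgue" for i
        using union(2) by (intro sets_completionI_sets) (auto simp: borel_eq_box)
      then have "(LINT x:(\<Union>i. F i)|lebesgue. f x) = (\<Sum>i. (LINT x:F i|lebesgue. f x))"
        using union(1) by (intro lebesgue_integral_countable_add si) (auto simp: disjoint_family_on_def)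
      then show ?case using union(3) by simp
    qed
  qed
  show ?thesis
  proof (rule density_unique_real[OF f])
    fix A :: "'a set" assume A: "A \<in> sets lebesgue"
    obtain C T where CT: "fsigma C" "T \<in> null_sets lebesgue" "C \<union> T = A"
      using lebesgue_set_almost_fsigma[OF A] by metis
    have C: "C \<in> sets borel" using CT(1) by (auto simp: fsigma.simps intro: borel_closed sets.countable_UN)
    have "AE x in lebesgue. x \<notin> T" using CT(2) by (rule AE_not_in)
    then have "(LINT x:A|lebesgue. f x) = (LINT x:C|lebesgue. f x)"
      using CT(3) borel_measurable_integrable[OF si[unfolded set_integrable_def]] A C
      by (intro set_integral_cong_set) (auto simp: set_borel_measurable_def)
    then show "(LINT x:A|lebesgue. f x) = (LINT x:A|lebesgue. 0)" using borel[OF C] by simp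
  qed simp
qed

lemma locally_integrable_cbox_indicator:
  assumes "locally_integrable \<Omega> v" "open \<Omega>" "cbox a b \<subseteq> \<Omega>"
  shows "integrable (lebesgue_on \<Omega>) (\<lambda>x. indicator (cbox a b) x * v x)"
    and "integrable lebesgue (\<lambda>x. indicator (cbox a b) x * v x)"
proof -
  have \<Omega>: "\<Omega> \<in> sets lebesgue" using assms(2) by (simp add: borel_open sets_completionI_sets)
  have "integrable (lebesgue_on (cbox a b)) v"
    using assms by (auto simp: locally_integrable_def)
  then show *: "integrable lebesgue (\<lambda>x. indicator (cbox a b) x * v x)"
    by (simp add: integrable_restrict_space)
  have eq: "(\<lambda>x. indicator \<Omega> x *\<^sub>R (indicator (cbox a b) x * v x)) = (\<lambda>x. indicator (cbox a b) x * v x)"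
    using assms(3) by (auto simp: fun_eq_iff indicator_def)
  show "integrable (lebesgue_on \<Omega>) (\<lambda>x. indicator (cbox a b) x * v x)"
    using \<Omega> * by (subst integrable_restrict_space) (simp_all only: eq space_completion space_lborel space_borel Int_UNIV_right)
qed

text \<open>Dominated convergence replaces bumps by the indicator. The majorant is the absolute
  value of \<open>v\<close> on the closed box, integrable because that box is a compact subset of
  \<open>\<Omega>\<close>.\<close>

lemma box_integral_0:
  fixes \<Omega> :: "(real^'d::finite) set"
  assumes \<Omega>: "open \<Omega>" and v: "locally_integrable \<Omega> v"
    and orth: "\<And>\<phi>. test_function \<Omega> \<phi> \<Longrightarrow> (LINT x|lebesgue_on \<Omega>. v x * \<phi> x) = 0"
    and ab: "cbox a b \<subseteq> \<Omega>"
  shows "(LINT x:box a b|lebesgue. v x) = 0"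
proof -
  have S: "\<Omega> \<in> sets lebesgue" using \<Omega> by (simp add: borel_open sets_completionI_sets)
  have meas [measurable]: "v \<in> borel_measurable (lebesgue_on \<Omega>)" using v by (simp add: locally_integrable_def)
  have bump: "test_function \<Omega> (box_bump a b n)" for n using ab by (rule test_function_box_bump)
  have "(\<lambda>n. LINT x|lebesgue_on \<Omega>. v x * box_bump a b n x)
    \<longlonglongrightarrow> (LINT x|lebesgue_on \<Omega>. v x * indicator (box a b) x)"
  proof (rule integral_dominated_convergence[where w = "\<lambda>x. \<bar>indicator (cbox a b) x * v x\<bar>"])
    show "integrable (lebesgue_on \<Omega>) (\<lambda>x. \<bar>indicator (cbox a b) x * v x\<bar>)"
      using locally_integrable_cbox_indicator(1)[OF v \<Omega> ab] by simp
    show "AE x in lebesgue_on \<Omega>. (\<lambda>n. v x * box_bump a b n x) \<longlonglongrightarrow> v x * indicator (box a b) x"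
      by (intro AE_I2 tendsto_intros box_bump_tendsto)
    show "(\<lambda>x. v x * indicator (box a b) x) \<in> borel_measurable (lebesgue_on \<Omega>)"
      by (intro borel_measurable_times meas borel_measurable_indicator) (use ab box_subset_cbox[of a b] in \<open>auto simp: sets_restrict_space_iff S\<close>)
    show "(\<lambda>x. v x * box_bump a b n x) \<in> borel_measurable (lebesgue_on \<Omega>)" for n
      by (intro borel_measurable_times meas test_function_measurable[OF bump])
    show "AE x in lebesgue_on \<Omega>. norm (v x * box_bump a b n x) \<le> \<bar>indicator (cbox a b) x * v x\<bar>" for n
    proof (rule AE_I2)
      fix x
      show "norm (v x * box_bump a b n x) \<le> \<bar>indicator (cbox a b) x * v x\<bar>"
        using box_bump_bounds[of a b n x] box_bump_eq_0[of x a b n] box_subset_cbox[of a b]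
          mult_left_le[of "box_bump a b n x" "\<bar>v x\<bar>"]
        by (cases "x \<in> box a b") (auto simp: abs_mult)
    qed
  qed
  then have "0 = (LINT x|lebesgue_on \<Omega>. v x * indicator (box a b) x)"
    by (simp add: orth[OF bump] LIMSEQ_const_iff)
  also have "\<dots> = (LINT x|lebesgue. indicator \<Omega> x * (v x * indicator (box a b) x))"
    using S by (simp add: integral_restrict_space)
  also have "\<dots> = (LINT x:box a b|lebesgue. v x)"
    unfolding set_lebesgue_integral_def using ab box_subset_cbox[of a b]
    by (intro Bochner_Integration.integral_cong) (auto simp: indicator_def)
  finally show ?thesis by simp
qed

text \<open>\<open>v\<close> is only locally integrable, so it is cut off to one box inside
  \<open>\<Omega>\<close> at a time. Countably many such boxes cover \<open>\<Omega>\<close>, which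
  keeps the union of the exceptional sets null.\<close>

lemma fundamental_lemma_variations:
  fixes \<Omega> :: "(real^'d::finite) set"
  assumes \<Omega>: "open \<Omega>" and v: "locally_integrable \<Omega> v"
    and orth: "\<And>\<phi>. test_function \<Omega> \<phi> \<Longrightarrow> (LINT x|lebesgue_on \<Omega>. v x * \<phi> x) = 0"
  shows "AE x in lebesgue_on \<Omega>. v x = 0"
proof -
  have S: "\<Omega> \<in> sets lebesgue" using \<Omega> by (simp add: borel_open sets_completionI_sets)
  have local: "AE x in lebesgue. x \<in> box A B \<longrightarrow> v x = 0" if AB: "cbox A B \<subseteq> \<Omega>" for A B
  proof -
    let ?f = "\<lambda>x. indicator (box A B) x * v x"
    have "integrable lebesgue (\<lambda>x. indicator (box A B) x *\<^sub>R (indicator (cbox A B) x * v x))"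
      by (intro integrable_mult_indicator locally_integrable_cbox_indicator[OF v \<Omega> AB]) simp
    moreover have "(\<lambda>x. indicator (box A B) x *\<^sub>R (indicator (cbox A B) x * v x)) = ?f"
      using box_subset_cbox[of A B] by (auto simp: fun_eq_iff indicator_def)
    ultimately have "integrable lebesgue ?f" by (simp only:)
    then have "AE x in lebesgue. ?f x = 0"
    proof (rule integral_boxes_0_imp_AE_0)
      fix a b :: "real^'d"
      \<comment> \<open>The cut-off turns a box into its intersection with \<open>box A B\<close>,
        again a box; the closed box with the same corners stays inside
        \<open>\<Omega>\<close>.\<close>
      obtain c d where cd: "box a b \<inter> box A B = box c d" "cbox a b \<inter> cbox A B = cbox c d"
        by (rule that[OF box_Int_box Int_interval])
      have "(LINT x:box a b|lebesgue. ?f x) = (LINT x:box c d|lebesgue. v x)"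
        unfolding set_lebesgue_integral_def cd(1)[symmetric]
        by (intro Bochner_Integration.integral_cong) (auto simp: indicator_def)
      also have "\<dots> = 0" using AB cd by (intro box_integral_0[OF \<Omega> v orth]) auto
      finally show "(LINT x:box a b|lebesgue. ?f x) = 0" .
    qed
    then show ?thesis by eventually_elim (auto simp: indicator_def)
  qed
  let ?F = "{box A B | A B. cbox A B \<subseteq> \<Omega>}"
  obtain G where G: "G \<subseteq> ?F" "countable G" "\<Union>G = \<Union>?F"
    by (rule Lindelof[of ?F]) auto
  have "\<Union>?F = \<Omega>"
  proof
    show "\<Union>?F \<subseteq> \<Omega>" using box_subset_cbox by blast
    show "\<Omega> \<subseteq> \<Union>?F"
    proof
      fix x assume "x \<in> \<Omega>"
      then obtain A B where "cbox A B \<subseteq> \<Omega>" "x \<in> box A B" using open_contains_cbox[OF \<Omega>] by metis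
      then show "x \<in> \<Union>?F" by blast
    qed
  qed
  moreover have "AE x in lebesgue. \<forall>S\<in>G. x \<in> S \<longrightarrow> v x = 0"
    using G(1,2) local by (subst AE_ball_countable) auto
  then have "AE x in lebesgue. x \<in> \<Union>G \<longrightarrow> v x = 0" by eventually_elim auto
  ultimately show ?thesis using G(3) S by (simp add: AE_restrict_space_iff)
qed

section \<open>Weak gradients\<close>

text \<open>Both sides of the weak derivative identity thus become pairings with test functions. Off
  its closed support \<open>\<phi>\<close> vanishes locally, hence so does its derivative.\<close>

lemma test_function_partial:
  assumes "test_function \<Omega> \<phi>"
  shows "test_function \<Omega> (classical_partial i \<phi>)"
proof -
  let ?S = "closure {x. \<phi> x \<noteq> 0}"
  have "C_k (Suc k) \<phi>" for k using assms unfolding test_function_def by blast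
  then have C: "C_k k (classical_partial i \<phi>)" for k by simp
  have "classical_partial i \<phi> x = 0" if "x \<notin> ?S" for x
  proof -
    have "((\<lambda>x. 0::real) has_derivative (\<lambda>h. 0)) (at x)" by simp
    then have "(\<phi> has_derivative (\<lambda>h. 0)) (at x)"
      by (rule has_derivative_transform_within_open[OF _ open_Compl[OF closed_closure, of "{x. \<phi> x \<noteq> 0}"]])
        (use that closure_subset[of "{x. \<phi> x \<noteq> 0}"] in auto)
    then show ?thesis by (rule classical_partial_eq)
  qed
  then have sub: "closure {x. classical_partial i \<phi> x \<noteq> 0} \<subseteq> ?S"
    by (intro closure_minimal) auto
  moreover have "compact ?S" "?S \<subseteq> \<Omega>" using assms by (auto simp: test_function_def)
  ultimately have "compact (closure {x. classical_partial i \<phi> x \<noteq> 0})"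
    by (meson bounded_subset closed_closure compact_eq_bounded_closed)
  then show ?thesis using C sub \<open>?S \<subseteq> \<Omega>\<close> unfolding test_function_def by blast
qed

text \<open>The integral of a non-integrable function is 0 by convention, so linearity of the
  pairing with test functions rests on this.\<close>

lemma integrable_times_test_function:
  assumes v: "locally_integrable \<Omega> v" and \<Omega>: "open \<Omega>" and \<phi>: "test_function \<Omega> \<phi>"
  shows "integrable (lebesgue_on \<Omega>) (\<lambda>x. v x * \<phi> x)"
proof -
  let ?S = "closure {x. \<phi> x \<noteq> 0}"
  have S: "compact ?S" "?S \<subseteq> \<Omega>" using \<phi> by (auto simp: test_function_def)
  have \<Omega>': "\<Omega> \<in> sets lebesgue" using \<Omega> by (simp add: borel_open sets_completionI_sets)
  have S': "?S \<in> sets lebesgue" by (simp add: borel_closed sets_completionI_sets)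
  have "C_k 0 \<phi>" using \<phi> unfolding test_function_def by blast
  then have "compact (\<phi> ` ?S)"
    by (intro compact_continuous_image S) (auto intro: continuous_on_subset)
  then obtain B where B: "\<And>x. x \<in> ?S \<Longrightarrow> \<bar>\<phi> x\<bar> \<le> B"
    using compact_imp_bounded by (fastforce simp: bounded_iff)
  have "integrable (lebesgue_on ?S) v" using v S by (simp add: locally_integrable_def)
  then have "integrable (lebesgue_on ?S) (\<lambda>x. B * v x)" by simp
  then have "integrable (lebesgue_on ?S) (\<lambda>x. v x * \<phi> x)"
  proof (rule Bochner_Integration.integrable_bound)
    show "(\<lambda>x. v x * \<phi> x) \<in> borel_measurable (lebesgue_on ?S)"
      using \<open>integrable (lebesgue_on ?S) v\<close>
      by (intro borel_measurable_times test_function_measurable[OF \<phi>] borel_measurable_integrable)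
    show "AE x in lebesgue_on ?S. norm (v x * \<phi> x) \<le> norm (B * v x)"
    proof (rule AE_I2)
      fix x assume "x \<in> space (lebesgue_on ?S)"
      then have "\<bar>\<phi> x\<bar> \<le> \<bar>B\<bar>" using B[of x] by simp
      then show "norm (v x * \<phi> x) \<le> norm (B * v x)"
        by (simp add: abs_mult mult.commute mult_right_mono)
    qed
  qed
  then have "integrable lebesgue (\<lambda>x. indicator ?S x *\<^sub>R (v x * \<phi> x))"
    using S' by (subst (asm) integrable_restrict_space) auto
  also have "(\<lambda>x. indicator ?S x *\<^sub>R (v x * \<phi> x)) = (\<lambda>x. indicator \<Omega> x *\<^sub>R (v x * \<phi> x))"
    using S(2) closure_subset[of "{x. \<phi> x \<noteq> 0}"] by (auto simp: fun_eq_iff indicator_def)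
  finally show ?thesis using \<Omega>' by (subst integrable_restrict_space) auto
qed

lemma locally_integrable_lincomb:
  assumes "locally_integrable \<Omega> u" "locally_integrable \<Omega> v"
  shows "locally_integrable \<Omega> (\<lambda>x. a * u x + b * v x)"
  using assms unfolding locally_integrable_def by auto

lemma has_weak_partial_lincomb:
  assumes \<Omega>: "open \<Omega>" and u: "has_weak_partial \<Omega> u i v" and u': "has_weak_partial \<Omega> u' i v'"
  shows "has_weak_partial \<Omega> (\<lambda>x. a * u x + b * u' x) i (\<lambda>x. a * v x + b * v' x)"
  unfolding has_weak_partial_def
proof (intro conjI allI impI)
  show "locally_integrable \<Omega> (\<lambda>x. a * u x + b * u' x)" "locally_integrable \<Omega> (\<lambda>x. a * v x + b * v' x)"
    using u u' by (auto simp: has_weak_partial_def intro: locally_integrable_lincomb)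
  fix \<phi> assume \<phi>: "test_function \<Omega> \<phi>"
  note int = integrable_times_test_function[OF _ \<Omega>]
  have lin: "(LINT x|lebesgue_on \<Omega>. (a * f x + b * g x) * \<psi> x) =
      a * (LINT x|lebesgue_on \<Omega>. f x * \<psi> x) + b * (LINT x|lebesgue_on \<Omega>. g x * \<psi> x)"
    if "locally_integrable \<Omega> f" "locally_integrable \<Omega> g" "test_function \<Omega> \<psi>" for f g \<psi>
    using int[OF that(1) that(3)] int[OF that(2) that(3)] by (simp add: distrib_right mult.assoc)
  show "(LINT x|lebesgue_on \<Omega>. (a * u x + b * u' x) * classical_partial i \<phi> x) =
    - (LINT x|lebesgue_on \<Omega>. (a * v x + b * v' x) * \<phi> x)"
    using u u' \<phi> test_function_partial[OF \<phi>, of i] by (simp add: has_weak_partial_def lin)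
qed

text \<open>Two functions equal almost everywhere are compared because the algebra of
  \<open>J\<close> holds only in that sense. The coefficients \<open>1\<close> and
  \<open>- 1\<close> make the difference an instance of
  \<open>has_weak_partial_lincomb\<close>.\<close>

lemma has_weak_partial_unique:
  assumes \<Omega>: "open \<Omega>" and u: "has_weak_partial \<Omega> u i v" and u': "has_weak_partial \<Omega> u' i v'"
    and eq: "AE x in lebesgue_on \<Omega>. u x = u' x"
  shows "AE x in lebesgue_on \<Omega>. v x = v' x"
proof -
  have "AE x in lebesgue_on \<Omega>. 1 * v x + (- 1) * v' x = 0"
  proof (rule fundamental_lemma_variations[OF \<Omega>])
    have D: "has_weak_partial \<Omega> (\<lambda>x. 1 * u x + (- 1) * u' x) i (\<lambda>x. 1 * v x + (- 1) * v' x)"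
      using \<Omega> u u' by (rule has_weak_partial_lincomb)
    then show "locally_integrable \<Omega> (\<lambda>x. 1 * v x + (- 1) * v' x)"
      unfolding has_weak_partial_def by blast
    fix \<phi> assume \<phi>: "test_function \<Omega> \<phi>"
    have "(LINT x|lebesgue_on \<Omega>. (1 * u x + (- 1) * u' x) * classical_partial i \<phi> x) = 0"
      by (rule integral_eq_zero_AE) (use eq in eventually_elim, simp)
    moreover have "(LINT x|lebesgue_on \<Omega>. (1 * u x + (- 1) * u' x) * classical_partial i \<phi> x) =
        - (LINT x|lebesgue_on \<Omega>. (1 * v x + (- 1) * v' x) * \<phi> x)"
      using D \<phi> unfolding has_weak_partial_def by blast
    ultimately show "(LINT x|lebesgue_on \<Omega>. (1 * v x + (- 1) * v' x) * \<phi> x) = 0" by linarith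
  qed
  then show ?thesis by eventually_elim simp
qed

lemma has_weak_gradient_lincomb:
  "open \<Omega> \<Longrightarrow> has_weak_gradient \<Omega> u g \<Longrightarrow> has_weak_gradient \<Omega> v h \<Longrightarrow>
    has_weak_gradient \<Omega> (\<lambda>x. a * u x + b * v x) (\<lambda>x. a *\<^sub>R g x + b *\<^sub>R h x)"
  unfolding has_weak_gradient_def by (auto intro: has_weak_partial_lincomb)

lemma has_weak_gradient_unique:
  assumes "open \<Omega>" "has_weak_gradient \<Omega> u g" "has_weak_gradient \<Omega> v h"
    and "AE x in lebesgue_on \<Omega>. u x = v x"
  shows "AE x in lebesgue_on \<Omega>. g x = h x"
proof -
  have "AE x in lebesgue_on \<Omega>. g x $ i = h x $ i" for i
    using assms has_weak_partial_unique unfolding has_weak_gradient_def by blast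
  then have "AE x in lebesgue_on \<Omega>. \<forall>i. g x $ i = h x $ i" by (simp add: AE_all_countable)
  then show ?thesis by eventually_elim (simp add: vec_eq_iff)
qed

lemma has_weak_gradient_weak_gradient:
  "u \<in> H1 \<Omega> \<Longrightarrow> has_weak_gradient \<Omega> u (weak_gradient \<Omega> u)"
  unfolding weak_gradient_def H1_def by (auto simp: some_eq_ex)

lemma L2_lincomb:
  assumes "u \<in> L2 \<Omega>" "v \<in> L2 \<Omega>"
  shows "(\<lambda>x. a * u x + b * v x) \<in> L2 \<Omega>"
proof -
  have [measurable]: "u \<in> borel_measurable (lebesgue_on \<Omega>)" "v \<in> borel_measurable (lebesgue_on \<Omega>)"
    and int: "integrable (lebesgue_on \<Omega>) (\<lambda>x. (u x)\<^sup>2)" "integrable (lebesgue_on \<Omega>) (\<lambda>x. (v x)\<^sup>2)"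
    using assms by (auto simp: L2_def)
  have "integrable (lebesgue_on \<Omega>) (\<lambda>x. 2 * a\<^sup>2 * (u x)\<^sup>2 + 2 * b\<^sup>2 * (v x)\<^sup>2)" using int by simp
  then have "integrable (lebesgue_on \<Omega>) (\<lambda>x. (a * u x + b * v x)\<^sup>2)"
  proof (rule Bochner_Integration.integrable_bound)
    have "norm ((a * s + b * t)\<^sup>2) \<le> norm (2 * a\<^sup>2 * s\<^sup>2 + 2 * b\<^sup>2 * t\<^sup>2)" for s t
    proof -
      have "2 * a\<^sup>2 * s\<^sup>2 + 2 * b\<^sup>2 * t\<^sup>2 - (a * s + b * t)\<^sup>2 = (a * s - b * t)\<^sup>2"
        by (simp add: power2_eq_square algebra_simps)
      then have "(a * s + b * t)\<^sup>2 \<le> 2 * a\<^sup>2 * s\<^sup>2 + 2 * b\<^sup>2 * t\<^sup>2" by (smt (verit) zero_le_power2)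
      then show ?thesis by simp
    qed
    then show "AE x in lebesgue_on \<Omega>. norm ((a * u x + b * v x)\<^sup>2) \<le> norm (2 * a\<^sup>2 * (u x)\<^sup>2 + 2 * b\<^sup>2 * (v x)\<^sup>2)"
      by simp
  qed measurable
  then show ?thesis by (simp add: L2_def)
qed

text \<open>\<open>H1\<close> promises some gradient with components in L2, while
  \<open>weak_gradient\<close> is an arbitrary choice; uniqueness carries square integrability
  over.\<close>

lemma weak_gradient_L2:
  assumes "open \<Omega>" "u \<in> H1 \<Omega>"
  shows "(\<lambda>x. weak_gradient \<Omega> u x $ i) \<in> L2 \<Omega>"
proof -
  obtain g where g: "has_weak_gradient \<Omega> u g" "\<And>i. (\<lambda>x. g x $ i) \<in> L2 \<Omega>"
    using assms(2) by (auto simp: H1_def)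
  have w: "has_weak_gradient \<Omega> u (weak_gradient \<Omega> u)" using assms(2) by (rule has_weak_gradient_weak_gradient)
  then have meas: "(\<lambda>x. weak_gradient \<Omega> u x $ i) \<in> borel_measurable (lebesgue_on \<Omega>)"
    by (auto simp: has_weak_gradient_def has_weak_partial_def locally_integrable_def)
  have "AE x in lebesgue_on \<Omega>. g x = weak_gradient \<Omega> u x"
    using has_weak_gradient_unique[OF assms(1) g(1) w] by simp
  then have "AE x in lebesgue_on \<Omega>. (g x $ i)\<^sup>2 = (weak_gradient \<Omega> u x $ i)\<^sup>2"
    by eventually_elim simp
  then have "integrable (lebesgue_on \<Omega>) (\<lambda>x. (weak_gradient \<Omega> u x $ i)\<^sup>2)"
    using g(2)[of i] meas by (subst integrable_cong_AE[symmetric]) (auto simp: L2_def)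
  with meas show ?thesis by (simp add: L2_def)
qed

lemma H1_lincomb:
  assumes "open \<Omega>" "u \<in> H1 \<Omega>" "v \<in> H1 \<Omega>"
  shows "(\<lambda>x. a * u x + b * v x) \<in> H1 \<Omega>"
proof -
  have "has_weak_gradient \<Omega> (\<lambda>x. a * u x + b * v x) (\<lambda>x. a *\<^sub>R weak_gradient \<Omega> u x + b *\<^sub>R weak_gradient \<Omega> v x)"
    using assms by (intro has_weak_gradient_lincomb has_weak_gradient_weak_gradient)
  moreover have "(\<lambda>x. (a *\<^sub>R weak_gradient \<Omega> u x + b *\<^sub>R weak_gradient \<Omega> v x) $ i) \<in> L2 \<Omega>" for i
    using L2_lincomb[OF weak_gradient_L2[OF assms(1,2)] weak_gradient_L2[OF assms(1,3)]] by simp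
  moreover have "(\<lambda>x. a * u x + b * v x) \<in> L2 \<Omega>" using assms by (intro L2_lincomb) (auto simp: H1_def)
  ultimately show ?thesis unfolding H1_def by blast
qed

lemma weak_gradient_lincomb:
  assumes "open \<Omega>" "u \<in> H1 \<Omega>" "v \<in> H1 \<Omega>" "w \<in> H1 \<Omega>"
    and "AE x in lebesgue_on \<Omega>. w x = a * u x + b * v x"
  shows "AE x in lebesgue_on \<Omega>. weak_gradient \<Omega> w x = a *\<^sub>R weak_gradient \<Omega> u x + b *\<^sub>R weak_gradient \<Omega> v x"
  by (rule has_weak_gradient_unique[OF assms(1) has_weak_gradient_weak_gradient[OF assms(4)]
    has_weak_gradient_lincomb[OF assms(1) has_weak_gradient_weak_gradient[OF assms(2)]
      has_weak_gradient_weak_gradient[OF assms(3)]] assms(5)])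

section \<open>Integral estimates for the squared gradient norm\<close>

lemma W_eq_norm: "W \<Omega> u x = (norm (weak_gradient \<Omega> u x))\<^sup>2"
  by (simp add: W_def norm_vec_def L2_set_def sum_nonneg)

lemma W_nonneg: "0 \<le> W \<Omega> u x"
  by (simp add: W_eq_norm)

lemma grad_supp_eq: "grad_supp \<Omega> u = {x \<in> \<Omega>. W \<Omega> u x \<noteq> 0}"
  by (auto simp: grad_supp_def W_eq_norm)

lemma integrable_W:
  "open \<Omega> \<Longrightarrow> u \<in> H1 \<Omega> \<Longrightarrow> integrable (lebesgue_on \<Omega>) (W \<Omega> u)"
  using weak_gradient_L2[of \<Omega> u] by (auto simp: W_def[abs_def] L2_def)

lemma integral_W_le_H1_norm:
  assumes "open \<Omega>" "u \<in> H1 \<Omega>"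
  shows "(LINT x|lebesgue_on \<Omega>. W \<Omega> u x) \<le> (H1_norm \<Omega> u)\<^sup>2"
proof -
  have "(LINT x|lebesgue_on \<Omega>. W \<Omega> u x) = (\<Sum>i\<in>UNIV. LINT x|lebesgue_on \<Omega>. (weak_gradient \<Omega> u x $ i)\<^sup>2)"
    using weak_gradient_L2[OF assms] by (simp add: W_def L2_def)
  then show ?thesis by (simp add: H1_norm_def sum_nonneg)
qed

lemma norm_sq_convex:
  fixes x y :: "'a::real_inner"
  assumes "0 \<le> t" "t \<le> 1"
  shows "(norm ((1 - t) *\<^sub>R x + t *\<^sub>R y))\<^sup>2 \<le> (1 - t) * (norm x)\<^sup>2 + t * (norm y)\<^sup>2"
proof -
  have "(1 - t) * (norm x)\<^sup>2 + t * (norm y)\<^sup>2 - (norm ((1 - t) *\<^sub>R x + t *\<^sub>R y))\<^sup>2 = t * (1 - t) * (norm (x - y))\<^sup>2"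
    by (simp add: power2_norm_eq_inner inner_add_left inner_add_right inner_diff_left inner_diff_right
        inner_commute algebra_simps)
  moreover have "0 \<le> t * (1 - t) * (norm (x - y))\<^sup>2" using assms by simp
  ultimately show ?thesis by linarith
qed

lemma integral_W_convex:
  assumes "open \<Omega>" "u \<in> H1 \<Omega>" "v \<in> H1 \<Omega>" "w \<in> H1 \<Omega>"
    and "AE x in lebesgue_on \<Omega>. w x = (1 - t) * u x + t * v x" and t: "0 \<le> t" "t \<le> 1"
  shows "(LINT x|lebesgue_on \<Omega>. W \<Omega> w x) \<le>
    (1 - t) * (LINT x|lebesgue_on \<Omega>. W \<Omega> u x) + t * (LINT x|lebesgue_on \<Omega>. W \<Omega> v x)"
proof -
  note int = integrable_W[OF assms(1)]
  have "(LINT x|lebesgue_on \<Omega>. W \<Omega> w x) \<le> (LINT x|lebesgue_on \<Omega>. (1 - t) * W \<Omega> u x + t * W \<Omega> v x)"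
  proof (rule integral_mono_AE)
    show "AE x in lebesgue_on \<Omega>. W \<Omega> w x \<le> (1 - t) * W \<Omega> u x + t * W \<Omega> v x"
      using weak_gradient_lincomb[OF assms(1-5)]
      by eventually_elim (simp add: W_eq_norm norm_sq_convex t)
  qed (use int assms in auto)
  then show ?thesis using int assms by simp
qed

text \<open>A crude substitute for the triangle inequality in L2: the 2 comes from bounding the
  square of a sum by twice the sum of squares, and \<open>c = 1\<close>, \<open>c = - 1\<close>
  cover sums and differences.\<close>

lemma integral_W_add_le:
  fixes \<Omega> :: "(real^'d::finite) set"
  assumes "open \<Omega>" "u \<in> H1 \<Omega>" "v \<in> H1 \<Omega>" "w \<in> H1 \<Omega>"
    and "AE x in lebesgue_on \<Omega>. w x = u x + c * v x" and c: "\<bar>c\<bar> = 1"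
  shows "(LINT x|lebesgue_on \<Omega>. W \<Omega> w x) \<le>
    2 * (LINT x|lebesgue_on \<Omega>. W \<Omega> u x) + 2 * (LINT x|lebesgue_on \<Omega>. W \<Omega> v x)"
proof -
  note int = integrable_W[OF assms(1)]
  have sq: "(norm (x + c *\<^sub>R y))\<^sup>2 \<le> 2 * (norm x)\<^sup>2 + 2 * (norm y)\<^sup>2" for x y :: "real^'d"
  proof -
    have "(norm (x + c *\<^sub>R y))\<^sup>2 \<le> (norm x + norm y)\<^sup>2"
      using norm_triangle_ineq[of x "c *\<^sub>R y"] c by (intro power_mono) auto
    also have "\<dots> \<le> 2 * (norm x)\<^sup>2 + 2 * (norm y)\<^sup>2"
      using zero_le_power2[of "norm x - norm y"] unfolding power2_sum power2_diff by linarith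
    finally show ?thesis .
  qed
  have "AE x in lebesgue_on \<Omega>. w x = 1 * u x + c * v x" using assms(5) by simp
  note grad = weak_gradient_lincomb[OF assms(1-4) this]
  have "(LINT x|lebesgue_on \<Omega>. W \<Omega> w x) \<le> (LINT x|lebesgue_on \<Omega>. 2 * W \<Omega> u x + 2 * W \<Omega> v x)"
  proof (rule integral_mono_AE)
    show "AE x in lebesgue_on \<Omega>. W \<Omega> w x \<le> 2 * W \<Omega> u x + 2 * W \<Omega> v x"
      using grad by eventually_elim (use sq in \<open>simp add: W_eq_norm\<close>)
  qed (use int assms in auto)
  then show ?thesis using int assms by simp
qed

text \<open>Young's inequality with a free weight takes the place of Cauchy-Schwarz:
  \<open>\<delta>\<close> makes the term with \<open>v\<close> small, and then convergence makes the
  difference term small.\<close>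

lemma integral_W_diff_le:
  fixes \<Omega> :: "(real^'d::finite) set"
  assumes "open \<Omega>" "u \<in> H1 \<Omega>" "v \<in> H1 \<Omega>" and \<delta>: "\<delta> > 0"
  shows "(LINT x|lebesgue_on \<Omega>. \<bar>W \<Omega> u x - W \<Omega> v x\<bar>) \<le>
    (1 + 1 / \<delta>) * (LINT x|lebesgue_on \<Omega>. W \<Omega> (\<lambda>x. u x - v x) x) + \<delta> * (LINT x|lebesgue_on \<Omega>. W \<Omega> v x)"
proof -
  note int = integrable_W[OF assms(1)]
  have D: "(\<lambda>x. u x - v x) \<in> H1 \<Omega>" using H1_lincomb[OF assms(1-3), of 1 "-1"] by simp
  have sq: "\<bar>(norm x)\<^sup>2 - (norm y)\<^sup>2\<bar> \<le> (1 + 1 / \<delta>) * (norm (x - y))\<^sup>2 + \<delta> * (norm y)\<^sup>2" for x y :: "real^'d"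
  proof -
    define d where "d = norm (x - y)"
    have d: "\<bar>norm x - norm y\<bar> \<le> d" "norm x + norm y \<le> d + 2 * norm y" "d \<ge> 0"
      using norm_triangle_ineq3[of x y] norm_triangle_sub[of x y] by (auto simp: d_def)
    have "\<bar>(norm x)\<^sup>2 - (norm y)\<^sup>2\<bar> = \<bar>norm x - norm y\<bar> * (norm x + norm y)"
      by (simp add: power2_eq_square square_diff_square_factored abs_mult)
    also have "\<dots> \<le> d * (d + 2 * norm y)" using d by (intro mult_mono) auto
    also have "\<dots> \<le> (1 + 1 / \<delta>) * d\<^sup>2 + \<delta> * (norm y)\<^sup>2"
    proof -
      have "0 \<le> (d - \<delta> * norm y)\<^sup>2 / \<delta>" using \<delta> by simp
      also have "\<dots> = d\<^sup>2 / \<delta> - 2 * d * norm y + \<delta> * (norm y)\<^sup>2"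
        using \<delta> by (simp add: power2_eq_square field_simps)
      finally show ?thesis by (simp add: power2_eq_square algebra_simps)
    qed
    finally show ?thesis by (simp add: d_def)
  qed
  have "AE x in lebesgue_on \<Omega>. u x - v x = 1 * u x + (- 1) * v x" by simp
  note grad = weak_gradient_lincomb[OF assms(1-3) D this]
  have "(LINT x|lebesgue_on \<Omega>. \<bar>W \<Omega> u x - W \<Omega> v x\<bar>) \<le>
      (LINT x|lebesgue_on \<Omega>. (1 + 1 / \<delta>) * W \<Omega> (\<lambda>x. u x - v x) x + \<delta> * W \<Omega> v x)"
  proof (rule integral_mono_AE)
    show "AE x in lebesgue_on \<Omega>. \<bar>W \<Omega> u x - W \<Omega> v x\<bar> \<le>
        (1 + 1 / \<delta>) * W \<Omega> (\<lambda>x. u x - v x) x + \<delta> * W \<Omega> v x"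
      using grad by eventually_elim (use sq in \<open>simp add: W_eq_norm\<close>)
  qed (use int assms D in auto)
  then show ?thesis using int[OF D] int[OF assms(3)] by simp
qed

section \<open>The compact embedding and the sparsity functionals\<close>

text \<open>\<open>q\<close> is the squared gradient distance to the H1-limit \<open>w\<close>,
  which is not known to come from \<open>U\<close>. It is convex and small on tails, hence small on
  their hulls, and \<open>q_close\<close> extends this to the closures. So \<open>q\<close> vanishes
  at the common point \<open>u\<close>, and the gradients converge to that of
  \<open>J u\<close>.\<close>

lemma compact_embedding_subsequence:
  fixes \<Omega> :: "(real^'d::finite) set" and J :: "'u::banach \<Rightarrow> real^'d \<Rightarrow> real"
  assumes \<Omega>: "open \<Omega>" and refl: "reflexive_space TYPE('u)" and emb: "compactly_embedded_H1 \<Omega> J"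
    and bdd: "bounded (range s)"
  obtains r :: "nat \<Rightarrow> nat" and u where "strict_mono r"
    and "(\<lambda>n. LINT x|lebesgue_on \<Omega>. W \<Omega> (\<lambda>x. J (s (r n)) x - J u x) x) \<longlonglongrightarrow> 0"
    and "\<And>n. u \<in> closure (convex hull ((s \<circ> r) ` {n..}))"
proof -
  have H: "J u \<in> H1 \<Omega>" for u using emb by (simp add: compactly_embedded_H1_def)
  have add: "AE x in lebesgue_on \<Omega>. J (u + v) x = J u x + J v x" for u v
    using emb by (simp add: compactly_embedded_H1_def)
  have scale: "AE x in lebesgue_on \<Omega>. J (c *\<^sub>R u) x = c * J u x" for c u
    using emb by (simp add: compactly_embedded_H1_def)
  obtain C where C: "\<And>u. H1_norm \<Omega> (J u) \<le> C * norm u"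
    using emb unfolding compactly_embedded_H1_def by blast
  obtain r w where r: "strict_mono (r :: nat \<Rightarrow> nat)" and w: "w \<in> H1 \<Omega>"
    and lim: "(\<lambda>n. H1_norm \<Omega> (\<lambda>x. J (s (r n)) x - w x)) \<longlonglongrightarrow> 0"
    using emb bdd unfolding compactly_embedded_H1_def by blast
  have D: "(\<lambda>x. v x - v' x) \<in> H1 \<Omega>" if "v \<in> H1 \<Omega>" "v' \<in> H1 \<Omega>" for v v'
    using H1_lincomb[OF \<Omega> that, of 1 "-1"] by simp
  define E where "E v = (LINT x|lebesgue_on \<Omega>. W \<Omega> v x)" for v
  have E0: "0 \<le> E v" for v unfolding E_def by (intro integral_nonneg_AE AE_I2 W_nonneg)
  define q where "q u = E (\<lambda>x. J u x - w x)" for u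
  have q_convex: "q ((1 - t) *\<^sub>R u + t *\<^sub>R v) \<le> (1 - t) * q u + t * q v" if "0 \<le> t" "t \<le> 1" for t u v
    unfolding q_def E_def
  proof (rule integral_W_convex[OF \<Omega> D[OF H w] D[OF H w] D[OF H w] _ that])
    show "AE x in lebesgue_on \<Omega>. J ((1 - t) *\<^sub>R u + t *\<^sub>R v) x - w x = (1 - t) * (J u x - w x) + t * (J v x - w x)"
      using add[of "(1 - t) *\<^sub>R u" "t *\<^sub>R v"] scale[of "1 - t" u] scale[of t v]
      by eventually_elim (simp add: algebra_simps)
  qed
  have q_close: "q u \<le> 2 * q v + 2 * (C * norm (u - v))\<^sup>2" for u v
  proof -
    have "q u \<le> 2 * q v + 2 * E (J (u - v))"
      unfolding q_def E_def
    proof (rule integral_W_add_le[OF \<Omega> D[OF H w] H D[OF H w], where c = 1])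
      show "AE x in lebesgue_on \<Omega>. J u x - w x = J v x - w x + 1 * J (u - v) x"
        using add[of v "u - v"] by eventually_elim simp
    qed simp
    also have "E (J (u - v)) \<le> (H1_norm \<Omega> (J (u - v)))\<^sup>2"
      unfolding E_def by (rule integral_W_le_H1_norm[OF \<Omega> H])
    also have "\<dots> \<le> (C * norm (u - v))\<^sup>2"
      using C by (intro power_mono) (auto simp: H1_norm_def intro!: add_nonneg_nonneg sum_nonneg)
    finally show ?thesis by simp
  qed
  have q_lim: "(\<lambda>n. q (s (r n))) \<longlonglongrightarrow> 0"
  proof (rule tendsto_sandwich[OF _ _ tendsto_const])
    show "eventually (\<lambda>n. 0 \<le> q (s (r n))) sequentially" by (simp add: q_def E0)
    show "eventually (\<lambda>n. q (s (r n)) \<le> (H1_norm \<Omega> (\<lambda>x. J (s (r n)) x - w x))\<^sup>2) sequentially"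
      unfolding q_def E_def by (intro always_eventually allI integral_W_le_H1_norm \<Omega> D H w)
    show "(\<lambda>n. (H1_norm \<Omega> (\<lambda>x. J (s (r n)) x - w x))\<^sup>2) \<longlonglongrightarrow> 0"
      using tendsto_power[OF lim, of 2] by simp
  qed
  let ?K = "\<lambda>n. closure (convex hull ((s \<circ> r) ` {n..}))"
  have "(\<Inter>n. ?K n) \<noteq> {}"
  proof (rule reflexive_decseq_convex_Inter[OF refl])
    show "decseq ?K" by (intro decseq_SucI closure_mono hull_mono image_mono) auto
    show "bounded (?K 0)"
      by (intro bounded_closure bounded_convex_hull bounded_subset[OF bdd]) auto
  qed (auto intro: convex_closure)
  then obtain u where u: "\<And>n. u \<in> ?K n" by auto
  have "q u \<le> 0 + e" if "e > 0" for e
  proof -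
    \<comment> \<open>The threshold \<open>e / 2\<close> absorbs the factor 2 of
      \<open>q_close\<close>.\<close>
    have "eventually (\<lambda>n. q (s (r n)) < e / 2) sequentially"
      using q_lim that by (intro order_tendstoD) auto
    then obtain N where N: "\<And>n. n \<ge> N \<Longrightarrow> q (s (r n)) < e / 2" by (auto simp: eventually_sequentially)
    have "convex {v. q v \<le> e / 2}"
      unfolding convex_alt
    proof (intro ballI allI impI)
      fix a b t assume "a \<in> {v. q v \<le> e / 2}" "b \<in> {v. q v \<le> e / 2}" "0 \<le> t \<and> (t::real) \<le> 1"
      then have "(1 - t) * q a + t * q b \<le> (1 - t) * (e / 2) + t * (e / 2)"
        by (intro add_mono mult_left_mono) auto
      also have "\<dots> = e / 2" by (simp flip: distrib_right)
      finally show "(1 - t) *\<^sub>R a + t *\<^sub>R b \<in> {v. q v \<le> e / 2}"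
        using q_convex[of t a b] \<open>0 \<le> t \<and> t \<le> 1\<close> by simp
    qed
    then have "convex hull ((s \<circ> r) ` {N..}) \<subseteq> {v. q v \<le> e / 2}"
      using N by (intro hull_minimal) (auto intro: less_imp_le)
    moreover obtain v where v: "\<And>k. v k \<in> convex hull ((s \<circ> r) ` {N..})" "v \<longlonglongrightarrow> u"
      using u[of N] by (auto simp: closure_sequential)
    ultimately have "q (v k) \<le> e / 2" for k by blast
    then have le: "q u \<le> e + 2 * (C * norm (u - v k))\<^sup>2" for k using q_close[of u "v k"] by (smt (verit) field_sum_of_halves)
    have "(\<lambda>k. e + 2 * (C * norm (u - v k))\<^sup>2) \<longlonglongrightarrow> e + 2 * (C * norm (u - u))\<^sup>2"
      by (intro tendsto_intros v)
    then have "q u \<le> e + 2 * (C * norm (u - u))\<^sup>2" by (rule LIMSEQ_le_const) (use le in blast)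
    then show ?thesis by simp
  qed
  then have qu: "q u \<le> 0" by (rule field_le_epsilon)
  have "(\<lambda>n. E (\<lambda>x. J (s (r n)) x - J u x)) \<longlonglongrightarrow> 0"
  proof (rule tendsto_sandwich[OF _ _ tendsto_const])
    show "eventually (\<lambda>n. 0 \<le> E (\<lambda>x. J (s (r n)) x - J u x)) sequentially" by (simp add: E0)
    show "eventually (\<lambda>n. E (\<lambda>x. J (s (r n)) x - J u x) \<le> 2 * q (s (r n))) sequentially"
    proof (intro always_eventually allI)
      fix n
      have "E (\<lambda>x. J (s (r n)) x - J u x) \<le> 2 * q (s (r n)) + 2 * q u"
        unfolding q_def E_def
        by (rule integral_W_add_le[OF \<Omega> D[OF H w] D[OF H w] D[OF H H], where c = "-1"]) simp_all
      then show "E (\<lambda>x. J (s (r n)) x - J u x) \<le> 2 * q (s (r n))" using qu by simp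
    qed
    show "(\<lambda>n. 2 * q (s (r n))) \<longlonglongrightarrow> 0" using tendsto_mult_right[OF q_lim, of 2] by simp
  qed
  then show ?thesis using r u by (intro that[of r u]) (auto simp: E_def)
qed

lemma W_tendsto_L1:
  fixes \<Omega> :: "(real^'d::finite) set"
  assumes \<Omega>: "open \<Omega>" and H: "\<And>n. v n \<in> H1 \<Omega>" "u \<in> H1 \<Omega>"
    and lim: "(\<lambda>n. LINT x|lebesgue_on \<Omega>. W \<Omega> (\<lambda>x. v n x - u x) x) \<longlonglongrightarrow> 0"
  shows "(\<lambda>n. LINT x|lebesgue_on \<Omega>. \<bar>W \<Omega> (v n) x - W \<Omega> u x\<bar>) \<longlonglongrightarrow> 0"
proof (rule order_tendstoI)
  let ?I = "LINT x|lebesgue_on \<Omega>. W \<Omega> u x"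
  have I: "0 \<le> ?I" by (intro integral_nonneg_AE AE_I2 W_nonneg)
  fix e :: real assume e: "0 < e"
  \<comment> \<open>Chosen so that \<open>\<delta> * ?I\<close> is at most \<open>e / 2\<close>; the
    summand 1 covers a vanishing integral.\<close>
  define \<delta> where "\<delta> = e / (2 * (?I + 1))"
  have \<delta>: "\<delta> > 0" using e I by (simp add: \<delta>_def)
  have "\<delta> * ?I = e / 2 * (?I / (?I + 1))" by (simp add: \<delta>_def)
  also have "\<dots> \<le> e / 2 * 1" using e I by (intro mult_left_mono) auto
  finally have \<delta>I: "\<delta> * ?I \<le> e / 2" by simp
  have "(\<lambda>n. (1 + 1 / \<delta>) * (LINT x|lebesgue_on \<Omega>. W \<Omega> (\<lambda>x. v n x - u x) x) + \<delta> * ?I)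
      \<longlonglongrightarrow> (1 + 1 / \<delta>) * 0 + \<delta> * ?I"
    by (intro tendsto_intros lim)
  then have "eventually (\<lambda>n. (1 + 1 / \<delta>) * (LINT x|lebesgue_on \<Omega>. W \<Omega> (\<lambda>x. v n x - u x) x) + \<delta> * ?I < e) sequentially"
    by (rule order_tendstoD) (use \<delta>I e in simp)
  then show "eventually (\<lambda>n. (LINT x|lebesgue_on \<Omega>. \<bar>W \<Omega> (v n) x - W \<Omega> u x\<bar>) < e) sequentially"
  proof eventually_elim
    case (elim n)
    with integral_W_diff_le[OF \<Omega> H(1) H(2) \<delta>, of n] show ?case by linarith
  qed
next
  fix e :: real assume "e < 0"
  moreover have "0 \<le> (LINT x|lebesgue_on \<Omega>. \<bar>W \<Omega> (v n) x - W \<Omega> u x\<bar>)" for n by simp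
  ultimately show "eventually (\<lambda>n. e < (LINT x|lebesgue_on \<Omega>. \<bar>W \<Omega> (v n) x - W \<Omega> u x\<bar>)) sequentially"
    by (intro always_eventually allI) (rule less_le_trans)
qed

section \<open>The largest-K-norm and the penalty\<close>

lemma integral_abs_subset_le:
  fixes a :: "'a::euclidean_space \<Rightarrow> real"
  assumes "\<Omega> \<in> sets lebesgue" "A \<in> sets lebesgue" "A \<subseteq> \<Omega>" and a: "integrable (lebesgue_on \<Omega>) a"
  shows "integrable (lebesgue_on A) a" "(LINT x|lebesgue_on A. \<bar>a x\<bar>) \<le> (LINT x|lebesgue_on \<Omega>. \<bar>a x\<bar>)"
proof -
  have \<Omega>: "integrable lebesgue (\<lambda>x. indicator \<Omega> x *\<^sub>R a x)"
    using a assms(1) by (subst (asm) integrable_restrict_space) auto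
  then have "integrable lebesgue (\<lambda>x. indicator A x *\<^sub>R (indicator \<Omega> x *\<^sub>R a x))"
    using assms(2) by (rule integrable_mult_indicator[rotated])
  also have "(\<lambda>x. indicator A x *\<^sub>R (indicator \<Omega> x *\<^sub>R a x)) = (\<lambda>x. indicator A x *\<^sub>R a x)"
    using assms(3) by (auto simp: fun_eq_iff indicator_def)
  finally have A: "integrable lebesgue (\<lambda>x. indicator A x *\<^sub>R a x)" .
  then show "integrable (lebesgue_on A) a" using assms(2) by (subst integrable_restrict_space) auto
  have eq: "(LINT x|lebesgue_on B. \<bar>a x\<bar>) = (LINT x|lebesgue. \<bar>indicator B x *\<^sub>R a x\<bar>)" if "B \<in> sets lebesgue" for B
    using that by (subst integral_restrict_space) (auto simp: abs_mult)
  show "(LINT x|lebesgue_on A. \<bar>a x\<bar>) \<le> (LINT x|lebesgue_on \<Omega>. \<bar>a x\<bar>)"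
    unfolding eq[OF assms(1)] eq[OF assms(2)]
    using A \<Omega> assms(3) by (intro integral_mono integrable_abs) (auto simp: indicator_def)
qed

lemma largest_K_norm_upper:
  assumes \<Omega>: "\<Omega> \<in> sets lebesgue" and a: "integrable (lebesgue_on \<Omega>) a"
    and A: "A \<in> sets lebesgue" "A \<subseteq> \<Omega>" "measure lebesgue A \<le> K"
  shows "(LINT x|lebesgue_on A. \<bar>a x\<bar>) \<le> largest_K_norm \<Omega> K a"
  unfolding largest_K_norm_def using A integral_abs_subset_le(2)[OF \<Omega> _ _ a]
  by (intro cSUP_upper bdd_aboveI2[where M = "LINT x|lebesgue_on \<Omega>. \<bar>a x\<bar>"]) auto

text \<open>\<open>0 \<le> K\<close> makes the empty set admissible, so the supremum is over a
  nonempty family.\<close>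

lemma largest_K_norm_least:
  assumes "0 \<le> K"
    and "\<And>A. A \<in> sets lebesgue \<Longrightarrow> A \<subseteq> \<Omega> \<Longrightarrow> measure lebesgue A \<le> K \<Longrightarrow> (LINT x|lebesgue_on A. \<bar>a x\<bar>) \<le> b"
  shows "largest_K_norm \<Omega> K a \<le> b"
  unfolding largest_K_norm_def using assms by (intro cSUP_least) (auto intro: exI[of _ "{}"])

lemma largest_K_norm_le_L1_norm:
  assumes "\<Omega> \<in> sets lebesgue" "integrable (lebesgue_on \<Omega>) a" "0 \<le> K"
  shows "largest_K_norm \<Omega> K a \<le> L1_norm \<Omega> a"
  unfolding L1_norm_def using assms by (intro largest_K_norm_least integral_abs_subset_le(2))

text \<open>Each integral over an admissible set is 1-Lipschitz in the L1 distance, and a supremum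
  preserves this. Exchanging \<open>a\<close> and \<open>b\<close> gives the other half.\<close>

lemma largest_K_norm_diff_le:
  assumes \<Omega>: "\<Omega> \<in> sets lebesgue" and a: "integrable (lebesgue_on \<Omega>) a" and b: "integrable (lebesgue_on \<Omega>) b"
    and K: "0 \<le> K"
  shows "largest_K_norm \<Omega> K a - largest_K_norm \<Omega> K b \<le> (LINT x|lebesgue_on \<Omega>. \<bar>a x - b x\<bar>)"
proof -
  have "largest_K_norm \<Omega> K a \<le> largest_K_norm \<Omega> K b + (LINT x|lebesgue_on \<Omega>. \<bar>a x - b x\<bar>)"
  proof (rule largest_K_norm_least[OF K])
    fix A assume A: "A \<in> sets lebesgue" "A \<subseteq> \<Omega>" "measure lebesgue A \<le> K"
    have d: "integrable (lebesgue_on \<Omega>) (\<lambda>x. a x - b x)" using a b by simp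
    note int = integral_abs_subset_le[OF \<Omega> A(1,2)]
    have "(LINT x|lebesgue_on A. \<bar>a x\<bar>) \<le> (LINT x|lebesgue_on A. \<bar>b x\<bar> + \<bar>a x - b x\<bar>)"
      using int(1)[OF a] int(1)[OF b] by (intro integral_mono) auto
    also have "\<dots> = (LINT x|lebesgue_on A. \<bar>b x\<bar>) + (LINT x|lebesgue_on A. \<bar>a x - b x\<bar>)"
      using int(1)[OF b] int(1)[OF d] by simp
    also have "\<dots> \<le> largest_K_norm \<Omega> K b + (LINT x|lebesgue_on \<Omega>. \<bar>a x - b x\<bar>)"
      using largest_K_norm_upper[OF \<Omega> b A] int(2)[OF d] by simp
    finally show "(LINT x|lebesgue_on A. \<bar>a x\<bar>) \<le> largest_K_norm \<Omega> K b + (LINT x|lebesgue_on \<Omega>. \<bar>a x - b x\<bar>)" .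
  qed
  then show ?thesis by simp
qed

lemma penalty_tendsto:
  fixes \<Omega> :: "(real^'d::finite) set"
  assumes \<Omega>: "open \<Omega>" and H: "\<And>n. v n \<in> H1 \<Omega>" "u \<in> H1 \<Omega>" and K: "0 \<le> K"
    and lim: "(\<lambda>n. LINT x|lebesgue_on \<Omega>. \<bar>W \<Omega> (v n) x - W \<Omega> u x\<bar>) \<longlonglongrightarrow> 0"
  shows "(\<lambda>n. penalty \<Omega> K (v n)) \<longlonglongrightarrow> penalty \<Omega> K u"
proof -
  have S: "\<Omega> \<in> sets lebesgue" using \<Omega> by (simp add: borel_open sets_completionI_sets)
  let ?d = "\<lambda>n. LINT x|lebesgue_on \<Omega>. \<bar>W \<Omega> (v n) x - W \<Omega> u x\<bar>"
  \<comment> \<open>Both terms of the penalty are 1-Lipschitz in \<open>W\<close> for the L1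
    distance, whence the factor 2.\<close>
  have bound: "\<bar>penalty \<Omega> K (v n) - penalty \<Omega> K u\<bar> \<le> 2 * ?d n" for n
  proof -
    note W = integrable_W[OF \<Omega> H(1)[of n]] integrable_W[OF \<Omega> H(2)]
    have "\<bar>L1_norm \<Omega> (W \<Omega> (v n)) - L1_norm \<Omega> (W \<Omega> u)\<bar> \<le> ?d n"
    proof -
      have "L1_norm \<Omega> (W \<Omega> (v n)) - L1_norm \<Omega> (W \<Omega> u) = (LINT x|lebesgue_on \<Omega>. W \<Omega> (v n) x - W \<Omega> u x)"
        using W by (simp add: L1_norm_def W_nonneg)
      then show ?thesis by (simp add: integral_abs_bound)
    qed
    moreover have "\<bar>largest_K_norm \<Omega> K (W \<Omega> (v n)) - largest_K_norm \<Omega> K (W \<Omega> u)\<bar> \<le> ?d n"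
      using largest_K_norm_diff_le[OF S W K] largest_K_norm_diff_le[OF S W(2,1) K]
      by (simp add: abs_le_iff abs_minus_commute)
    ultimately show ?thesis by (simp add: penalty_def)
  qed
  have "(\<lambda>n. 2 * ?d n) \<longlonglongrightarrow> 0" using tendsto_mult_right[OF lim, of 2] by simp
  then have "(\<lambda>n. penalty \<Omega> K (v n) - penalty \<Omega> K u) \<longlonglongrightarrow> 0"
    by (rule Lim_null_comparison[rotated]) (use bound in simp)
  then show ?thesis by (rule LIM_zero_cancel)
qed

lemma penalty_nonneg:
  assumes "open \<Omega>" "u \<in> H1 \<Omega>" "0 \<le> K"
  shows "0 \<le> penalty \<Omega> K u"
  using largest_K_norm_le_L1_norm[OF _ integrable_W[OF assms(1,2)] assms(3)] assms(1)
  by (simp add: penalty_def borel_open sets_completionI_sets)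

section \<open>The measure of the gradient support\<close>

lemma sets_W_superlevel:
  assumes "open \<Omega>" "u \<in> H1 \<Omega>"
  shows "{x \<in> \<Omega>. c < W \<Omega> u x} \<in> sets lebesgue" "grad_supp \<Omega> u \<in> sets lebesgue"
proof -
  have S: "\<Omega> \<in> sets lebesgue" using assms by (simp add: borel_open sets_completionI_sets)
  have [measurable]: "W \<Omega> u \<in> borel_measurable (lebesgue_on \<Omega>)"
    using integrable_W[OF assms] by (rule borel_measurable_integrable)
  have "{x \<in> space (lebesgue_on \<Omega>). c < W \<Omega> u x} \<in> sets (lebesgue_on \<Omega>)"
    "{x \<in> space (lebesgue_on \<Omega>). W \<Omega> u x \<noteq> 0} \<in> sets (lebesgue_on \<Omega>)" by measurable
  then show "{x \<in> \<Omega>. c < W \<Omega> u x} \<in> sets lebesgue" "grad_supp \<Omega> u \<in> sets lebesgue"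
    using S by (auto simp: sets_restrict_space_iff grad_supp_eq)
qed

text \<open>The support itself competes in the supremum and carries the whole integral. This makes
  the given sparse point feasible for the constraint of vanishing penalty.\<close>

lemma penalty_eq_0_if_grad_L0_le:
  assumes \<Omega>: "open \<Omega>" and u: "u \<in> H1 \<Omega>" and K: "0 \<le> K" and le: "grad_L0 \<Omega> u \<le> K"
  shows "penalty \<Omega> K u = 0"
proof -
  have S: "\<Omega> \<in> sets lebesgue" using \<Omega> by (simp add: borel_open sets_completionI_sets)
  let ?A = "grad_supp \<Omega> u"
  have A: "?A \<in> sets lebesgue" "?A \<subseteq> \<Omega>" "measure lebesgue ?A \<le> K"
    using sets_W_superlevel(2)[OF \<Omega> u] le by (auto simp: grad_supp_def grad_L0_def)
  have "L1_norm \<Omega> (W \<Omega> u) = (LINT x|lebesgue. indicator \<Omega> x *\<^sub>R \<bar>W \<Omega> u x\<bar>)"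
    using S unfolding L1_norm_def by (subst integral_restrict_space) auto
  also have "\<dots> = (LINT x|lebesgue. indicator ?A x *\<^sub>R \<bar>W \<Omega> u x\<bar>)"
    by (intro Bochner_Integration.integral_cong) (auto simp: grad_supp_eq indicator_def)
  also have "\<dots> = (LINT x|lebesgue_on ?A. \<bar>W \<Omega> u x\<bar>)"
    using A(1) by (subst integral_restrict_space) auto
  also have "\<dots> \<le> largest_K_norm \<Omega> K (W \<Omega> u)"
    by (rule largest_K_norm_upper[OF S integrable_W[OF \<Omega> u] A])
  finally show ?thesis using penalty_nonneg[OF \<Omega> u K] by (simp add: penalty_def)
qed

text \<open>
  By Markov's inequality,
  \<open>{W u > \<delta>}\<close> exceeds the support of \<open>W (v n)\<close> by at most \<open>\<parallel>W (v n) - W u\<parallel>\<^sub>1 / \<delta>\<close>.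
\<close>
lemma grad_L0_le_limit:
  fixes \<Omega> :: "(real^'d::finite) set"
  assumes \<Omega>: "open \<Omega>" "bounded \<Omega>" and H: "\<And>n. v n \<in> H1 \<Omega>" "u \<in> H1 \<Omega>"
    and lim: "(\<lambda>n. LINT x|lebesgue_on \<Omega>. \<bar>W \<Omega> (v n) x - W \<Omega> u x\<bar>) \<longlonglongrightarrow> 0"
    and le: "\<And>n. grad_L0 \<Omega> (v n) \<le> K"
  shows "grad_L0 \<Omega> u \<le> K"
proof -
  have S: "\<Omega> \<in> sets lebesgue" using \<Omega> by (simp add: borel_open sets_completionI_sets)
  \<comment> \<open>\<open>measure\<close> is 0 on sets of infinite measure, so its monotonicity
    needs finiteness; boundedness of \<open>\<Omega>\<close> supplies it.\<close>
  have lm: "A \<in> lmeasurable" if "A \<in> sets lebesgue" "A \<subseteq> \<Omega>" for A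
    using that \<Omega>(2) bounded_set_imp_lmeasurable bounded_subset by blast
  let ?d = "\<lambda>n. LINT x|lebesgue_on \<Omega>. \<bar>W \<Omega> (v n) x - W \<Omega> u x\<bar>"
  let ?L = "\<lambda>\<delta>. {x \<in> \<Omega>. \<delta> < W \<Omega> u x}"
  have level: "measure lebesgue (?L \<delta>) \<le> K" if \<delta>: "\<delta> > 0" for \<delta>
  proof -
    have "measure lebesgue (?L \<delta>) \<le> K + ?d n / \<delta>" for n
    proof -
      let ?B = "?L \<delta> - grad_supp \<Omega> (v n)"
      have m: "?L \<delta> \<in> lmeasurable" "grad_supp \<Omega> (v n) \<in> lmeasurable" "?B \<in> lmeasurable"
        using sets_W_superlevel[OF \<Omega>(1) H(1)] sets_W_superlevel[OF \<Omega>(1) H(2)]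
        by (auto intro!: lm simp: grad_supp_def)
      have "integrable (lebesgue_on \<Omega>) (\<lambda>x. \<bar>W \<Omega> (v n) x - W \<Omega> u x\<bar>)"
        using integrable_W[OF \<Omega>(1) H(1)[of n]] integrable_W[OF \<Omega>(1) H(2)] by simp
      then have int: "integrable lebesgue (\<lambda>x. indicator \<Omega> x *\<^sub>R \<bar>W \<Omega> (v n) x - W \<Omega> u x\<bar>)"
        using S by (subst (asm) integrable_restrict_space) auto
      have "\<delta> * measure lebesgue ?B = (LINT x|lebesgue. \<delta> * indicator ?B x)" using m by simp
      also have "\<dots> \<le> (LINT x|lebesgue. indicator \<Omega> x *\<^sub>R \<bar>W \<Omega> (v n) x - W \<Omega> u x\<bar>)"
      proof (rule integral_mono[OF _ int])
        show "integrable lebesgue (\<lambda>x. \<delta> * indicator ?B x)"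
          using m(3) by (intro integrable_mult_right integrable_real_indicator) (auto simp: fmeasurable_def)
        \<comment> \<open>On \<open>?B\<close> the function \<open>W \<Omega> (v n)\<close> vanishes
          while \<open>W \<Omega> u\<close> exceeds \<open>\<delta>\<close>.\<close>
        show "\<delta> * indicator ?B x \<le> indicator \<Omega> x *\<^sub>R \<bar>W \<Omega> (v n) x - W \<Omega> u x\<bar>" for x
          by (auto simp: grad_supp_eq indicator_def)
      qed
      also have "\<dots> = ?d n" using S by (subst integral_restrict_space) auto
      finally have B: "measure lebesgue ?B \<le> ?d n / \<delta>" using \<delta> by (simp add: field_simps)
      have "measure lebesgue (?L \<delta>) \<le> measure lebesgue (grad_supp \<Omega> (v n) \<union> ?B)"
        using m by (intro measure_mono_fmeasurable) auto
      also have "\<dots> \<le> measure lebesgue (grad_supp \<Omega> (v n)) + measure lebesgue ?B"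
        using m by (intro measure_Un_le) auto
      finally show ?thesis using B le[of n] by (simp add: grad_L0_def)
    qed
    moreover have "(\<lambda>n. K + ?d n / \<delta>) \<longlonglongrightarrow> K + 0 / \<delta>" by (intro tendsto_intros lim) (use \<delta> in simp)
    ultimately show ?thesis using LIMSEQ_le_const by fastforce
  qed
  \<comment> \<open>The support is an increasing union of superlevel sets at positive levels, so
    their common bound passes to it by continuity of the measure from below.\<close>
  have "(\<Union>k. ?L (1 / Suc k)) = grad_supp \<Omega> u"
  proof
    show "(\<Union>k. ?L (1 / Suc k)) \<subseteq> grad_supp \<Omega> u"
      by (auto simp: grad_supp_eq)
    show "grad_supp \<Omega> u \<subseteq> (\<Union>k. ?L (1 / Suc k))"
    proof
      fix x assume "x \<in> grad_supp \<Omega> u"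
      then have x: "x \<in> \<Omega>" "W \<Omega> u x > 0" using W_nonneg[of \<Omega> u x] by (auto simp: grad_supp_eq)
      then obtain k where "inverse (real (Suc k)) < W \<Omega> u x" using reals_Archimedean by blast
      then show "x \<in> (\<Union>k. ?L (1 / Suc k))" using x by (auto simp: inverse_eq_divide)
    qed
  qed
  moreover have "(\<lambda>k. measure lebesgue (?L (1 / Suc k))) \<longlonglongrightarrow> measure lebesgue (\<Union>k. ?L (1 / Suc k))"
  proof (rule Lim_measure_incseq)
    show "range (\<lambda>k. ?L (1 / Suc k)) \<subseteq> sets lebesgue" using sets_W_superlevel[OF \<Omega>(1) H(2)] by auto
    show "incseq (\<lambda>k. ?L (1 / Suc k))"
    proof (rule incseq_SucI)
      fix k
      have "1 / real (Suc (Suc k)) \<le> 1 / real (Suc k)" by (intro divide_left_mono) auto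
      then show "?L (1 / Suc k) \<subseteq> ?L (1 / Suc (Suc k))" by (auto intro: order_le_less_trans)
    qed
    have "grad_supp \<Omega> u \<in> lmeasurable"
      using sets_W_superlevel(2)[OF \<Omega>(1) H(2)] by (intro lm) (auto simp: grad_supp_def)
    then show "emeasure lebesgue (\<Union>k. ?L (1 / Suc k)) \<noteq> \<infinity>"
      unfolding calculation by (auto simp: fmeasurable_def)
  qed
  ultimately have "(\<lambda>k. measure lebesgue (?L (1 / Suc k))) \<longlonglongrightarrow> grad_L0 \<Omega> u" by (simp add: grad_L0_def)
  then show ?thesis by (rule LIMSEQ_le_const2) (use level in simp)
qed

section \<open>Existence of minimizers\<close>

theorem theorem3p4:
  fixes \<Omega> :: "(real^'d::finite) set"
    and J :: "'u::banach \<Rightarrow> real^'d \<Rightarrow> real"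
    and f :: "'u \<Rightarrow> ereal"
    and K \<rho> :: real
  assumes "open \<Omega>" and "bounded \<Omega>"
    and "reflexive_space TYPE('u)"
    and "compactly_embedded_H1 \<Omega> J"
    and "dense_in_L1 \<Omega> J"
    and "proper_fun f"
    and "ereal_convex f"
    and "lower_semicontinuous f"
    and "bounded_from_below f"
    and "radially_unbounded f"
    and "0 \<le> K" and "K \<le> measure lebesgue \<Omega>"
    and "\<rho> > 0"
    and "\<exists>u. f u < \<infinity> \<and> grad_L0 \<Omega> (J u) \<le> K"
  shows "(\<exists>u. is_arg_min f (\<lambda>u. grad_L0 \<Omega> (J u) \<le> K) u) \<and>
    (\<exists>u. is_arg_min f
       (\<lambda>u. L1_norm \<Omega> (W \<Omega> (J u)) - largest_K_norm \<Omega> K (W \<Omega> (J u)) = 0) u) \<and>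
    (\<exists>u. is_arg_min (\<lambda>u. f u + ereal (\<rho> * penalty \<Omega> K (J u))) (\<lambda>u. True) u)"
proof -
  have H: "J u \<in> H1 \<Omega>" for u using assms(4) by (simp add: compactly_embedded_H1_def)
  note nonneg = penalty_nonneg[OF assms(1) H assms(11)]
  obtain u0 where u0: "f u0 < \<infinity>" "grad_L0 \<Omega> (J u0) \<le> K" using assms(14) by blast
  have pen0: "penalty \<Omega> K (J u0) = 0"
    using penalty_eq_0_if_grad_L0_le[OF assms(1) H assms(11) u0(2)] .
  \<comment> \<open>The three problems differ only in the weight \<open>c\<close> and the constraint
    \<open>P\<close>. Closedness of \<open>P\<close> is asked only along sequences with the
    convergence that compactness provides.\<close>
  have minimizer: "\<exists>u. is_arg_min (\<lambda>u. f u + ereal (c * penalty \<Omega> K (J u))) P u"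
    if c: "0 \<le> c" and P: "P u0"
      and closed: "\<And>v u. (\<And>n. P (v n)) \<Longrightarrow> (\<lambda>n. penalty \<Omega> K (J (v n))) \<longlonglongrightarrow> penalty \<Omega> K (J u) \<Longrightarrow>
        (\<lambda>n. LINT x|lebesgue_on \<Omega>. \<bar>W \<Omega> (J (v n)) x - W \<Omega> (J u) x\<bar>) \<longlonglongrightarrow> 0 \<Longrightarrow> P u"
    for c P
  proof (rule direct_method[OF assms(6-10)])
    show "\<exists>u. P u \<and> f u < \<infinity>" using P u0 by blast
    show "0 \<le> c * penalty \<Omega> K (J u)" for u using c nonneg by simp
    fix s :: "nat \<Rightarrow> 'u" assume s: "bounded (range s)" "\<And>n. P (s n)"
    obtain r u where r: "strict_mono r"
      and lim: "(\<lambda>n. LINT x|lebesgue_on \<Omega>. W \<Omega> (\<lambda>x. J (s (r n)) x - J u x) x) \<longlonglongrightarrow> 0"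
      and hull: "\<And>n. u \<in> closure (convex hull ((s \<circ> r) ` {n..}))"
      using compact_embedding_subsequence[OF assms(1,3,4) s(1)] by blast
    have L1: "(\<lambda>n. LINT x|lebesgue_on \<Omega>. \<bar>W \<Omega> (J (s (r n))) x - W \<Omega> (J u) x\<bar>) \<longlonglongrightarrow> 0"
      by (rule W_tendsto_L1[OF assms(1) H H lim])
    have pen: "(\<lambda>n. penalty \<Omega> K (J (s (r n)))) \<longlonglongrightarrow> penalty \<Omega> K (J u)"
      by (rule penalty_tendsto[OF assms(1) H H assms(11) L1])
    have "P u" by (rule closed[OF _ pen L1]) (rule s(2))
    moreover have "(\<lambda>n. c * penalty \<Omega> K (J (s (r n)))) \<longlonglongrightarrow> c * penalty \<Omega> K (J u)"
      by (intro tendsto_intros pen)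
    ultimately show "\<exists>r u. strict_mono r \<and> P u \<and> (\<lambda>n. c * penalty \<Omega> K (J (s (r n)))) \<longlonglongrightarrow> c * penalty \<Omega> K (J u) \<and>
        (\<forall>n. u \<in> closure (convex hull ((s \<circ> r) ` {n..})))"
      using r hull by blast
  qed
  \<comment> \<open>Weight 0 leaves \<open>f\<close> as the objective. The first constraint is
    closed by lower semicontinuity of the support measure, the second by uniqueness of the limit of
    the penalties.\<close>
  have "\<exists>u. is_arg_min (\<lambda>u. f u + ereal (0 * penalty \<Omega> K (J u))) (\<lambda>u. grad_L0 \<Omega> (J u) \<le> K) u"
    by (rule minimizer) (use u0 grad_L0_le_limit[OF assms(1,2) H H] in auto)
  moreover have "\<exists>u. is_arg_min (\<lambda>u. f u + ereal (0 * penalty \<Omega> K (J u))) (\<lambda>u. penalty \<Omega> K (J u) = 0) u"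
    by (rule minimizer) (use pen0 in \<open>auto simp: LIMSEQ_const_iff\<close>)
  moreover have "\<exists>u. is_arg_min (\<lambda>u. f u + ereal (\<rho> * penalty \<Omega> K (J u))) (\<lambda>u. True) u"
    by (rule minimizer) (use assms(13) in auto)
  ultimately show ?thesis by (simp add: penalty_def flip: zero_ereal_def)
qed

end
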